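(* Let $X$ be a Banach space and let $J \subset \mathscr{L}(X)$ be a separable admissible Banach ideal. If $T \in \mathscr{L}(X)$ is an extended backward shift, then the generalised derivations $L_T - R_{-I} \colon J \to J$ and $L_{T'} - R_{-I} \colon J \to J$ satisfy the Hypercyclicity Criterion on $J$, where $T' = \sum_{j=1}^\infty \frac{1}{j!} T^j$.
   Context: $\mathscr{L}(X)$ is the space of bounded linear operators on $X$, and $I$ is the identity operator on $X$. For $A,B \in \mathscr{L}(X)$, $L_A(S) = AS$ and $R_B(S) = SB$ are the left and right multiplication operators, and the generalised derivation is $\tau_{A,B} = L_A - R_B$, i.e. $\tau_{A,B}(S) = AS - SB$; these are considered as bounded operators on $J$. Banach ideal: $(J, \lVert\cdot\rVert_J)$ is a Banach ideal of $\mathscr{L}(X)$ if (i) $J \subset \mathscr{L}(X)$ is a linear subspace; (ii) the norm $\lVert\cdot\rVert_J$ is complete in $J$ and $\lVert S\rVert \le \lVert S\rVert_J$ for all $S \in J$; (iii) $BSA \in J$ and $\lVert BSA\rVert_J \le \lVert B\rVert\,\lVert A\rVert\,\lVert S\rVert_J$ for all $A,B \in \mathscr{L}(X)$, $S \in J$; (iv) the rank one operators $x^*\otimes x \colon z \mapsto x^*(z)x$ belong to $J$ and $\lVert x^*\otimes x\rVert_J = \lVert x^*\rVert\,\lVert x\rVert$ for all $x^* \in X^*$, $x \in X$. It is admissible if the finite rank operators $\mathscr{F}(X) = \mathrm{span}\{x^*\otimes x : x^*\in X^*, x \in X\}$ are dense in $(J, \lVert\cdot\rVert_J)$. Separability of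 $J$ is with respect to $\lVert\cdot\rVert_J$. Extended backward shift: $T \in \mathscr{L}(X)$ such that $\mathrm{span}\left(\bigcup_{j=0}^\infty \left(\ker T^j \cap \operatorname{ran} T^j\right)\right)$ is dense in $X$. Hypercyclicity Criterion: a bounded operator $U$ on a separable Banach space $Y$ satisfies the Hypercyclicity Criterion if there exist a dense linear subspace $Y_0 \subset Y$, an increasing sequence $(n_k)$ of positive integers and linear maps $S_{n_k} \colon Y_0 \to Y$, $k \ge 1$, such that for every $y \in Y_0$, as $k \to \infty$: $U^{n_k} y \to 0$, $S_{n_k} y \to 0$, and $U^{n_k} S_{n_k} y \to y$. *)

theory Defs
  imports "HOL-Analysis.Analysis"
begin

text \<open>
  Banach spaces over a scalar field \<open>'k\<close>, with scalar multiplication \<open>sm\<close>. By the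
  Gelfand--Mazur theorem a commutative \<open>real_normed_field\<close> is the real or the complex field, so
  this covers exactly the real and the complex Banach spaces. Since \<open>sm\<close> extends \<open>*\<^sub>R\<close>, elements
  of \<open>'a \<Rightarrow>\<^sub>L 'a\<close> are only guaranteed to be real-linear; \<open>'k\<close>-linearity is imposed
  separately below.
\<close>

locale banach_space_over = vector_space sm
  for sm :: "'k::real_normed_field \<Rightarrow> 'a::banach \<Rightarrow> 'a" +
  assumes norm_scale: "norm (sm c x) = norm c * norm x"
    and scale_of_real: "sm (of_real r) x = r *\<^sub>R x"

definition bounded_ops :: "('k::real_normed_field \<Rightarrow> 'a::banach \<Rightarrow> 'a) \<Rightarrow> ('a \<Rightarrow>\<^sub>L 'a) set" where
  "bounded_ops sm = {S. Vector_Spaces.linear sm sm (blinfun_apply S)}"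

definition dual_space :: "('k::real_normed_field \<Rightarrow> 'a::banach \<Rightarrow> 'a) \<Rightarrow> ('a \<Rightarrow>\<^sub>L 'k) set" where
  "dual_space sm = {f. Vector_Spaces.linear sm (*) (blinfun_apply f)}"

definition op_scale ::
    "('k::real_normed_field \<Rightarrow> 'a::banach \<Rightarrow> 'a) \<Rightarrow> 'k \<Rightarrow> ('a \<Rightarrow>\<^sub>L 'a) \<Rightarrow> ('a \<Rightarrow>\<^sub>L 'a)" where
  "op_scale sm c S = Blinfun (\<lambda>x. sm c (blinfun_apply S x))"

definition rank_one ::
    "('k::real_normed_field \<Rightarrow> 'a::banach \<Rightarrow> 'a) \<Rightarrow> ('a \<Rightarrow>\<^sub>L 'k) \<Rightarrow> 'a \<Rightarrow> ('a \<Rightarrow>\<^sub>L 'a)" where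
  "rank_one sm f x = Blinfun (\<lambda>z. sm (blinfun_apply f z) x)"

definition finite_rank_ops ::
    "('k::real_normed_field \<Rightarrow> 'a::banach \<Rightarrow> 'a) \<Rightarrow> ('a \<Rightarrow>\<^sub>L 'a) set" where
  "finite_rank_ops sm =
     module.span (op_scale sm) {rank_one sm f x | f x. f \<in> dual_space sm}"

definition op_pow :: "('a::real_normed_vector \<Rightarrow>\<^sub>L 'a) \<Rightarrow> nat \<Rightarrow> ('a \<Rightarrow>\<^sub>L 'a)" where
  "op_pow T n = (((o\<^sub>L) T) ^^ n) id_blinfun"

definition left_mult :: "('a::real_normed_vector \<Rightarrow>\<^sub>L 'a) \<Rightarrow> ('a \<Rightarrow>\<^sub>L 'a) \<Rightarrow> ('a \<Rightarrow>\<^sub>L 'a)" where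
  "left_mult A = (\<lambda>S. A o\<^sub>L S)"

definition right_mult :: "('a::real_normed_vector \<Rightarrow>\<^sub>L 'a) \<Rightarrow> ('a \<Rightarrow>\<^sub>L 'a) \<Rightarrow> ('a \<Rightarrow>\<^sub>L 'a)" where
  "right_mult B = (\<lambda>S. S o\<^sub>L B)"

definition gen_derivation ::
    "('a::real_normed_vector \<Rightarrow>\<^sub>L 'a) \<Rightarrow> ('a \<Rightarrow>\<^sub>L 'a) \<Rightarrow> ('a \<Rightarrow>\<^sub>L 'a) \<Rightarrow> ('a \<Rightarrow>\<^sub>L 'a)" where
  "gen_derivation A B = (\<lambda>S. left_mult A S - right_mult B S)"

text \<open>
  Normed spaces on a carrier \<open>Y\<close>, the norm being a function \<open>N\<close> that is meaningful only on \<open>Y\<close>.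
  The distance is cut off outside \<open>Y\<close> because \<open>Metric_space\<close> requires nonnegativity and symmetry
  on the whole type; its restriction to \<open>Y\<close> is \<open>N (x - y)\<close>.
\<close>

definition norm_metric :: "'v::ab_group_add set \<Rightarrow> ('v \<Rightarrow> real) \<Rightarrow> 'v metric" where
  "norm_metric Y N = metric (Y, \<lambda>x y. if x \<in> Y \<and> y \<in> Y then N (x - y) else 0)"

definition norm_topology :: "'v::ab_group_add set \<Rightarrow> ('v \<Rightarrow> real) \<Rightarrow> 'v topology" where
  "norm_topology Y N = mtopology_of (norm_metric Y N)"

definition dense_in :: "'v topology \<Rightarrow> 'v set \<Rightarrow> bool" where
  "dense_in X D \<longleftrightarrow> D \<subseteq> topspace X \<and> X closure_of D = topspace X"

definition norm_on ::
    "('k::real_normed_field \<Rightarrow> 'v::ab_group_add \<Rightarrow> 'v) \<Rightarrow> 'v set \<Rightarrow> ('v \<Rightarrow> real) \<Rightarrow> bool" where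
  "norm_on sm Y N \<longleftrightarrow>
     (\<forall>x\<in>Y. 0 \<le> N x) \<and>
     (\<forall>x\<in>Y. N x = 0 \<longleftrightarrow> x = 0) \<and>
     (\<forall>c. \<forall>x\<in>Y. N (sm c x) = norm c * N x) \<and>
     (\<forall>x\<in>Y. \<forall>y\<in>Y. N (x + y) \<le> N x + N y)"

definition banach_on ::
    "('k::real_normed_field \<Rightarrow> 'v::ab_group_add \<Rightarrow> 'v) \<Rightarrow> 'v set \<Rightarrow> ('v \<Rightarrow> real) \<Rightarrow> bool" where
  "banach_on sm Y N \<longleftrightarrow>
     vector_space sm \<and> module.subspace sm Y \<and> norm_on sm Y N \<and>
     mcomplete_of (norm_metric Y N)"

definition linear_map_on ::
    "('k \<Rightarrow> 'v::ab_group_add \<Rightarrow> 'v) \<Rightarrow> 'v set \<Rightarrow> 'v set \<Rightarrow> ('v \<Rightarrow> 'v) \<Rightarrow> bool" where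
  "linear_map_on sm V W f \<longleftrightarrow>
     (\<forall>x\<in>V. f x \<in> W) \<and>
     (\<forall>x\<in>V. \<forall>y\<in>V. f (x + y) = f x + f y) \<and>
     (\<forall>c. \<forall>x\<in>V. f (sm c x) = sm c (f x))"

definition bounded_operator_on ::
    "('k \<Rightarrow> 'v::ab_group_add \<Rightarrow> 'v) \<Rightarrow> 'v set \<Rightarrow> ('v \<Rightarrow> real) \<Rightarrow> ('v \<Rightarrow> 'v) \<Rightarrow> bool" where
  "bounded_operator_on sm Y N U \<longleftrightarrow>
     linear_map_on sm Y Y U \<and> (\<exists>C. \<forall>x\<in>Y. N (U x) \<le> C * N x)"

text \<open>
  The standing assumptions (\<open>U\<close> is a bounded operator on the separable Banach space \<open>Y\<close>) are part
  of the predicate.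
\<close>

definition hypercyclicity_criterion ::
    "('k::real_normed_field \<Rightarrow> 'v::ab_group_add \<Rightarrow> 'v) \<Rightarrow> 'v set \<Rightarrow> ('v \<Rightarrow> real) \<Rightarrow> ('v \<Rightarrow> 'v) \<Rightarrow> bool"
  where
  "hypercyclicity_criterion sm Y N U \<longleftrightarrow>
     banach_on sm Y N \<and> separable_space (norm_topology Y N) \<and> bounded_operator_on sm Y N U \<and>
     (\<exists>Y0 (n :: nat \<Rightarrow> nat) (S :: nat \<Rightarrow> 'v \<Rightarrow> 'v).
        module.subspace sm Y0 \<and> dense_in (norm_topology Y N) Y0 \<and>
        strict_mono n \<and> (\<forall>k. 0 < n k) \<and>
        (\<forall>k. linear_map_on sm Y0 Y (S (n k))) \<and>
        (\<forall>y\<in>Y0.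
           limitin (norm_topology Y N) (\<lambda>k. (U ^^ n k) y) 0 sequentially \<and>
           limitin (norm_topology Y N) (\<lambda>k. S (n k) y) 0 sequentially \<and>
           limitin (norm_topology Y N) (\<lambda>k. (U ^^ n k) (S (n k) y)) y sequentially))"

definition banach_ideal ::
    "('k::real_normed_field \<Rightarrow> 'a::banach \<Rightarrow> 'a) \<Rightarrow> ('a \<Rightarrow>\<^sub>L 'a) set \<Rightarrow> (('a \<Rightarrow>\<^sub>L 'a) \<Rightarrow> real) \<Rightarrow> bool"
  where
  "banach_ideal sm J N \<longleftrightarrow>
     J \<subseteq> bounded_ops sm \<and>
     banach_on (op_scale sm) J N \<and>
     (\<forall>S\<in>J. norm S \<le> N S) \<and>
     (\<forall>A\<in>bounded_ops sm. \<forall>B\<in>bounded_ops sm. \<forall>S\<in>J.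
        B o\<^sub>L S o\<^sub>L A \<in> J \<and> N (B o\<^sub>L S o\<^sub>L A) \<le> norm B * norm A * N S) \<and>
     (\<forall>f\<in>dual_space sm. \<forall>x.
        rank_one sm f x \<in> J \<and> N (rank_one sm f x) = norm f * norm x)"

definition admissible_banach_ideal ::
    "('k::real_normed_field \<Rightarrow> 'a::banach \<Rightarrow> 'a) \<Rightarrow> ('a \<Rightarrow>\<^sub>L 'a) set \<Rightarrow> (('a \<Rightarrow>\<^sub>L 'a) \<Rightarrow> real) \<Rightarrow> bool"
  where
  "admissible_banach_ideal sm J N \<longleftrightarrow>
     banach_ideal sm J N \<and> dense_in (norm_topology J N) (finite_rank_ops sm)"

definition extended_backward_shift ::
    "('k::real_normed_field \<Rightarrow> 'a::banach \<Rightarrow> 'a) \<Rightarrow> ('a \<Rightarrow>\<^sub>L 'a) \<Rightarrow> bool" where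
  "extended_backward_shift sm T \<longleftrightarrow>
     T \<in> bounded_ops sm \<and>
     closure (module.span sm
       (\<Union>j. {x. blinfun_apply (op_pow T j) x = 0} \<inter> range (blinfun_apply (op_pow T j)))) = UNIV"

text \<open>
  Consistency checks: real and complex instances of the setting, and that \<open>op_scale\<close> and
  \<open>rank_one\<close> are never applied to an argument for which \<open>Blinfun\<close> is unspecified.
\<close>

lemma banach_space_over_real: "banach_space_over ((*\<^sub>R) :: real \<Rightarrow> 'a::banach \<Rightarrow> 'a)"
  by unfold_locales (auto simp: algebra_simps)

lemma banach_space_over_complex: "banach_space_over ((*) :: complex \<Rightarrow> complex \<Rightarrow> complex)"
  by unfold_locales (auto simp: algebra_simps norm_mult scaleR_conv_of_real)

context banach_space_over
begin

lemma scale_scaleR: "sm c (r *\<^sub>R x) = r *\<^sub>R sm c x"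
  by (metis scale_of_real scale_left_commute)

lemma bounded_linear_scale: "bounded_linear (sm c)"
  by (rule bounded_linear_intro[where K = "norm c"])
    (auto simp: scale_right_distrib scale_scaleR norm_scale mult.commute)

lemma op_scale_apply: "blinfun_apply (op_scale sm c S) x = sm c (blinfun_apply S x)"
  unfolding op_scale_def
  by (subst bounded_linear_Blinfun_apply)
    (auto intro!: bounded_linear_compose[OF bounded_linear_scale] blinfun.bounded_linear_right)

lemma vector_space_op_scale: "vector_space (op_scale sm)"
  by unfold_locales
    (auto intro!: blinfun_eqI simp: op_scale_apply blinfun.add_left scale_right_distrib
      scale_left_distrib)

lemma rank_one_apply: "blinfun_apply (rank_one sm f x) z = sm (blinfun_apply f z) x"
proof -
  have "bounded_linear (\<lambda>z. sm (blinfun_apply f z) x)"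
  proof (rule bounded_linear_intro[where K = "norm f * norm x"])
    fix u v r
    show "sm (blinfun_apply f (u + v)) x = sm (blinfun_apply f u) x + sm (blinfun_apply f v) x"
      by (simp add: blinfun.add_right scale_left_distrib)
    show "sm (blinfun_apply f (r *\<^sub>R u)) x = r *\<^sub>R sm (blinfun_apply f u) x"
      by (metis blinfun.scaleR_right scaleR_conv_of_real scale_of_real scale_scale)
    show "norm (sm (blinfun_apply f u) x) \<le> norm u * (norm f * norm x)"
      using mult_right_mono[OF norm_blinfun[of f u] norm_ge_zero[of x]]
      by (simp add: norm_scale mult_ac)
  qed
  then show ?thesis
    by (simp add: rank_one_def bounded_linear_Blinfun_apply)
qed

end

end

theory Submission
  imports Defs "HOL-Computational_Algebra.Formal_Power_Series"
begin

text \<open>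
  Since \<open>S - (- I) = S + I\<close>, the derivation \<open>L\<^sub>A - R\<^bsub>-I\<^esub>\<close> on \<open>J\<close> is left multiplication by
  \<open>I + A\<close>. So the operators in question are left multiplication by \<open>V = I + T\<close> and by
  \<open>V = exp T\<close>.

  Neither operator has an evident dense set of vectors whose orbits tend to \<open>0\<close>: on the
  generalised kernel of \<open>T\<close> the powers \<open>V\<^sup>n\<close> grow polynomially. What one does have is a weaker
  property that allows the starting vector to vary with \<open>n\<close>. Call \<open>y\<close> \<^emph>\<open>null-linked\<close> for \<open>U\<close> if
  there are \<open>v\<^sub>n \<rightarrow> y\<close> with \<open>U\<^sup>n v\<^sub>n \<rightarrow> 0\<close>, and \<open>u\<^sub>n \<rightarrow> 0\<close> with \<open>U\<^sup>n u\<^sub>n \<rightarrow> y\<close>. The proof has three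
  parts.

  \<^item> If the null-linked vectors are dense in a separable Banach space, then \<open>U\<close> satisfies the
    Hypercyclicity Criterion (\<open>hypercyclicity_criterion_if_null_linked_dense\<close>). By Baire's theorem
    some vector \<open>x\<close> has a dense orbit, and infinitely many \<open>n\<close> have \<open>U\<^sup>n x\<close> small and
    \<open>x\<close> nearly equal to \<open>U\<^sup>n u\<close> for a small \<open>u\<close>. Choose such \<open>n\<^sub>k\<close> and \<open>u\<^sub>k\<close>. A bounded operator
    \<open>P\<close> that commutes with \<open>U\<close> is determined by \<open>P x\<close>, because the orbit of \<open>x\<close> is dense. Hence
    \<open>Y\<^sub>0 = {P x}\<close> and \<open>S\<^sub>k (P x) = P u\<^sub>k\<close> make sense, and continuity of \<open>P\<close> transfers the three
    limits from \<open>x\<close> to \<open>P x\<close>.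

  \<^item> Every \<open>x \<in> ker T\<^sup>j \<inter> ran T\<^sup>j\<close> is null-linked for \<open>V\<close> (\<open>null_linked_if_exp_action\<close>). Write
    \<open>x = T\<^sup>j y\<close>, so that \<open>T\<^bsup>2j\<^esup> y = 0\<close> and real power series modulo \<open>X\<^bsup>2j\<^esup>\<close> act on \<open>y\<close>. In both
    cases \<open>V\<close> acts as \<open>exp L\<close> for a series \<open>L\<close> with \<open>L(0) = 0\<close> and \<open>L'(0) \<noteq> 0\<close>, namely \<open>L = X\<close> or
    \<open>L = ln (1 + X)\<close>, and \<open>V\<^sup>n\<close> acts as \<open>exp (n L)\<close>. A Pade approximation gives a polynomial \<open>Q\<close>
    of degree less than \<open>j\<close> such that \<open>Q(s) e\<^sup>s\<close> is a monic polynomial of degree \<open>j\<close> modulo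
    \<open>s\<^bsup>2j\<^esup>\<close>. Then \<open>n\<^bsup>-j\<^esup> Q(n L)\<close> tends to \<open>0\<close>, while \<open>exp (n L)\<close> carries it to \<open>L\<^sup>j + O(1/n)\<close>.
    Dividing by \<open>(L/X)\<^sup>j\<close> replaces the limit by \<open>X\<^sup>j\<close>, which sends \<open>y\<close> to \<open>x\<close>. With \<open>-n\<close> in
    place of \<open>n\<close> the same computation provides the other sequence.

  \<^item> Null-linked vectors form a subspace, and if \<open>x\<close> is null-linked for \<open>V\<close>, then \<open>f \<otimes> x\<close> is
    null-linked for left multiplication by \<open>V\<close>, since \<open>V\<^sup>n (f \<otimes> x) = f \<otimes> V\<^sup>n x\<close>. By the
    hypothesis on \<open>T\<close> and admissibility of \<open>J\<close>, these operators span a dense subspace of \<open>J\<close>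
    (\<open>null_linked_left_mult_dense\<close>).
\<close>

unbundle no vec_syntax
unbundle fps_syntax

section \<open>Normed spaces on a carrier\<close>

locale normed_carrier =
  fixes sm :: "'k::real_normed_field \<Rightarrow> 'v::ab_group_add \<Rightarrow> 'v" and Y N
  assumes vs: "vector_space sm" and sub: "module.subspace sm Y" and norm: "norm_on sm Y N"
begin

sublocale vector_space sm by (rule vs)

lemma carrier_closed [simp, intro]:
  "0 \<in> Y" "x \<in> Y \<Longrightarrow> y \<in> Y \<Longrightarrow> x + y \<in> Y" "x \<in> Y \<Longrightarrow> y \<in> Y \<Longrightarrow> x - y \<in> Y"
  "x \<in> Y \<Longrightarrow> - x \<in> Y" "x \<in> Y \<Longrightarrow> sm c x \<in> Y"
  using sub by (auto intro: subspace_0 subspace_add subspace_diff subspace_neg subspace_scale)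

lemma N_nonneg [simp]: "x \<in> Y \<Longrightarrow> 0 \<le> N x"
  and N_eq_0: "x \<in> Y \<Longrightarrow> N x = 0 \<longleftrightarrow> x = 0"
  and N_scale: "x \<in> Y \<Longrightarrow> N (sm c x) = norm c * N x"
  and N_add: "x \<in> Y \<Longrightarrow> y \<in> Y \<Longrightarrow> N (x + y) \<le> N x + N y"
  using norm by (auto simp: norm_on_def)

lemma N_0 [simp]: "N 0 = 0"
  using N_eq_0[of 0] by simp

lemma N_minus: "x \<in> Y \<Longrightarrow> N (- x) = N x"
  using N_scale[of x "- 1"] by simp

lemma N_diff_commute: "x \<in> Y \<Longrightarrow> y \<in> Y \<Longrightarrow> N (x - y) = N (y - x)"
  using N_minus[of "x - y"] by simp

lemma N_triangle: "x \<in> Y \<Longrightarrow> y \<in> Y \<Longrightarrow> z \<in> Y \<Longrightarrow> N (x - z) \<le> N (x - y) + N (y - z)"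
  using N_add[of "x - y" "y - z"] by simp

text \<open>
  The cut-off agrees with the one in \<open>norm_metric\<close>, so that the topology of the interpreted metric
  space is literally \<open>norm_topology\<close>.
\<close>

abbreviation carrier_dist where
  "carrier_dist \<equiv> \<lambda>x y. if x \<in> Y \<and> y \<in> Y then N (x - y) else 0"

sublocale metric: Metric_space Y carrier_dist
  by unfold_locales (auto simp: N_diff_commute N_eq_0 N_triangle)

lemma norm_topology_eq: "norm_topology Y N = metric.mtopology"
  by (simp add: norm_topology_def norm_metric_def)

lemma topspace_norm_topology [simp]: "topspace (norm_topology Y N) = Y"
  by (simp add: norm_topology_eq)

lemma dense_in_iff:
  assumes "D \<subseteq> Y"
  shows "dense_in (norm_topology Y N) D \<longleftrightarrow> (\<forall>y\<in>Y. \<forall>e>0. \<exists>x\<in>D. N (x - y) < e)"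
proof -
  have "y \<in> metric.mtopology closure_of D \<longleftrightarrow> (\<forall>e>0. \<exists>x\<in>D. N (x - y) < e)" if "y \<in> Y" for y
    using assms that unfolding metric.metric_closure_of
    by (auto simp: subset_iff N_diff_commute)
  moreover have "metric.mtopology closure_of D \<subseteq> Y"
    using closure_of_subset_topspace[of metric.mtopology D] by simp
  ultimately show ?thesis
    using assms by (auto simp: dense_in_def norm_topology_eq)
qed

lemma openin_norm_topology:
  assumes "W \<subseteq> Y" and "\<And>x. x \<in> W \<Longrightarrow> \<exists>e>0. \<forall>y\<in>Y. N (y - x) < e \<longrightarrow> y \<in> W"
  shows "openin (norm_topology Y N) W"
  unfolding norm_topology_eq metric.openin_mtopology
proof (intro conjI allI impI)
  fix x assume x: "x \<in> W"
  obtain e where "e > 0" "\<forall>y\<in>Y. N (y - x) < e \<longrightarrow> y \<in> W"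
    using assms(2)[OF x] by blast
  then show "\<exists>r>0. metric.mball x r \<subseteq> W"
    using x assms(1) by (intro exI[of _ e]) (auto simp: N_diff_commute subset_iff)
qed (rule assms(1))

lemma limitin_norm_topology:
  assumes "l \<in> Y" and "\<And>n. f n \<in> Y" and "(\<lambda>n. N (f n - l)) \<longlonglongrightarrow> 0"
  shows "limitin (norm_topology Y N) f l sequentially"
  unfolding norm_topology_eq metric.limitin_metric
proof (intro conjI allI impI)
  fix e :: real assume "e > 0"
  then have "\<forall>\<^sub>F n in sequentially. N (f n - l) < e"
    by (rule order_tendstoD(2)[OF assms(3)])
  then show "\<forall>\<^sub>F n in sequentially. f n \<in> Y \<and> carrier_dist (f n) l < e"
    by eventually_elim (simp add: assms)
qed (rule assms(1))

lemma tendsto_0_bound: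
  assumes "\<And>n. f n \<in> Y" and "\<And>n. N (f n) \<le> C * g n" and "g \<longlonglongrightarrow> 0"
  shows "(\<lambda>n. N (f n)) \<longlonglongrightarrow> 0"
proof (rule tendsto_sandwich[OF _ _ tendsto_const])
  show "(\<lambda>n. C * g n) \<longlonglongrightarrow> 0"
    using tendsto_mult_left[OF assms(3), of C] by simp
qed (use assms in auto)

lemma bounded_operator_on_props:
  assumes "bounded_operator_on sm Y N U"
  shows "x \<in> Y \<Longrightarrow> U x \<in> Y"
    and "x \<in> Y \<Longrightarrow> y \<in> Y \<Longrightarrow> U (x + y) = U x + U y"
    and "x \<in> Y \<Longrightarrow> U (sm c x) = sm c (U x)"
    and "x \<in> Y \<Longrightarrow> y \<in> Y \<Longrightarrow> U (x - y) = U x - U y"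
    and "U 0 = 0"
    and "\<exists>C>0. \<forall>x\<in>Y. N (U x) \<le> C * N x"
proof -
  have L: "\<And>x. x \<in> Y \<Longrightarrow> U x \<in> Y" "\<And>x y. x \<in> Y \<Longrightarrow> y \<in> Y \<Longrightarrow> U (x + y) = U x + U y"
     "\<And>c x. x \<in> Y \<Longrightarrow> U (sm c x) = sm c (U x)"
    using assms by (auto simp: bounded_operator_on_def linear_map_on_def)
  show "x \<in> Y \<Longrightarrow> U x \<in> Y" "x \<in> Y \<Longrightarrow> y \<in> Y \<Longrightarrow> U (x + y) = U x + U y"
    "x \<in> Y \<Longrightarrow> U (sm c x) = sm c (U x)"
    by (fact L)+
  show "U (x - y) = U x - U y" if "x \<in> Y" "y \<in> Y"
    using L(2)[of "x - y" y] that by (simp add: algebra_simps)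
  show "U 0 = 0"
    using L(2)[of 0 0] by simp
  obtain C where C: "\<forall>x\<in>Y. N (U x) \<le> C * N x"
    using assms by (auto simp: bounded_operator_on_def)
  have "N (U x) \<le> max C 1 * N x" if "x \<in> Y" for x
    using C that mult_right_mono[of C "max C 1" "N x"] by fastforce
  then show "\<exists>C>0. \<forall>x\<in>Y. N (U x) \<le> C * N x"
    by (intro exI[of _ "max C 1"]) auto
qed

lemma bounded_operator_on_id: "bounded_operator_on sm Y N (\<lambda>x. x)"
  by (auto simp: bounded_operator_on_def linear_map_on_def intro!: exI[of _ 1])

lemma bounded_operator_on_zero: "bounded_operator_on sm Y N (\<lambda>x. 0)"
  by (auto simp: bounded_operator_on_def linear_map_on_def intro!: exI[of _ 1])

lemma bounded_operator_on_compose: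
  assumes "bounded_operator_on sm Y N P" "bounded_operator_on sm Y N Q"
  shows "bounded_operator_on sm Y N (\<lambda>x. P (Q x))"
proof -
  note P = bounded_operator_on_props[OF assms(1)] and Q = bounded_operator_on_props[OF assms(2)]
  obtain C D where CD: "C > 0" "\<And>x. x \<in> Y \<Longrightarrow> N (P x) \<le> C * N x"
    "D > 0" "\<And>x. x \<in> Y \<Longrightarrow> N (Q x) \<le> D * N x"
    using P(6) Q(6) by blast
  have "N (P (Q x)) \<le> (C * D) * N x" if "x \<in> Y" for x
    using order_trans[OF CD(2)[OF Q(1)[OF that]] mult_left_mono[OF CD(4)[OF that], of C]] CD(1)
    by (simp add: mult.assoc)
  then show ?thesis
    unfolding bounded_operator_on_def linear_map_on_def using P Q by (auto intro!: exI[of _ "C * D"])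
qed

lemma bounded_operator_on_funpow:
  assumes "bounded_operator_on sm Y N U"
  shows "bounded_operator_on sm Y N (U ^^ n)"
proof (induction n)
  case 0
  then show ?case using bounded_operator_on_id by (simp add: id_def)
next
  case (Suc n)
  then show ?case using bounded_operator_on_compose[OF assms Suc] by (simp add: o_def)
qed

lemma bounded_operator_on_add:
  assumes "bounded_operator_on sm Y N P" "bounded_operator_on sm Y N Q"
  shows "bounded_operator_on sm Y N (\<lambda>x. P x + Q x)"
proof -
  note P = bounded_operator_on_props[OF assms(1)] and Q = bounded_operator_on_props[OF assms(2)]
  obtain C D where CD: "C > 0" "\<And>x. x \<in> Y \<Longrightarrow> N (P x) \<le> C * N x"
    "D > 0" "\<And>x. x \<in> Y \<Longrightarrow> N (Q x) \<le> D * N x"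
    using P(6) Q(6) by blast
  have "N (P x + Q x) \<le> (C + D) * N x" if "x \<in> Y" for x
    using N_add[OF P(1) Q(1), OF that that] CD(2)[OF that] CD(4)[OF that] by (simp add: algebra_simps)
  then show ?thesis
    unfolding bounded_operator_on_def linear_map_on_def using P Q
    by (auto simp: scale_right_distrib intro!: exI[of _ "C + D"])
qed

lemma bounded_operator_on_scale:
  assumes "bounded_operator_on sm Y N P"
  shows "bounded_operator_on sm Y N (\<lambda>x. sm c (P x))"
proof -
  note P = bounded_operator_on_props[OF assms(1)]
  obtain C where C: "C > 0" "\<And>x. x \<in> Y \<Longrightarrow> N (P x) \<le> C * N x"
    using P(6) by blast
  have "N (sm c (P x)) \<le> (norm c * C) * N x" if "x \<in> Y" for x
    using N_scale[OF P(1)[OF that]] mult_left_mono[OF C(2)[OF that], of "norm c"] by simp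
  then show ?thesis
    unfolding bounded_operator_on_def linear_map_on_def using P
    by (auto simp: scale_right_distrib scale_left_commute intro!: exI[of _ "norm c * C"])
qed

lemma bounded_operator_on_continuous:
  assumes "bounded_operator_on sm Y N U" and "x \<in> Y" and "e > 0"
  shows "\<exists>r>0. \<forall>y\<in>Y. N (y - x) < r \<longrightarrow> N (U y - U x) < e"
proof -
  note U = bounded_operator_on_props[OF assms(1)]
  obtain C where C: "C > 0" "\<And>x. x \<in> Y \<Longrightarrow> N (U x) \<le> C * N x"
    using U(6) by blast
  have "N (U y - U x) < e" if "y \<in> Y" "N (y - x) < e / C" for y
  proof -
    have "N (U y - U x) \<le> C * N (y - x)"
      using C(2)[of "y - x"] that assms(2) by (simp add: U(4))
    also have "\<dots> < e" using that C(1) by (simp add: field_simps)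
    finally show ?thesis .
  qed
  then show ?thesis using C(1) assms(3) by (intro exI[of _ "e / C"]) auto
qed

lemma bounded_operator_on_zero_if_zero_on_dense:
  assumes P: "bounded_operator_on sm Y N P"
    and D: "D \<subseteq> Y" "\<And>y e. y \<in> Y \<Longrightarrow> e > 0 \<Longrightarrow> \<exists>x\<in>D. N (x - y) < e"
    and 0: "\<And>x. x \<in> D \<Longrightarrow> P x = 0" and y: "y \<in> Y"
  shows "P y = 0"
proof (rule ccontr)
  note Pp = bounded_operator_on_props[OF P]
  assume "P y \<noteq> 0"
  then have "N (P y) > 0"
    using N_eq_0[OF Pp(1)[OF y]] N_nonneg[OF Pp(1)[OF y]] by linarith
  then obtain r where "r > 0" "\<forall>x\<in>Y. N (x - y) < r \<longrightarrow> N (P x - P y) < N (P y)"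
    using bounded_operator_on_continuous[OF P y] by blast
  moreover obtain x where "x \<in> D" "N (x - y) < r"
    using D(2)[OF y \<open>r > 0\<close>] by blast
  ultimately have "N (0 - P y) < N (P y)"
    using D(1) 0 by (metis subsetD)
  then show False using N_minus[OF Pp(1)[OF y]] by simp
qed

end

section \<open>Null-linked vectors and the Hypercyclicity Criterion\<close>

text \<open>
  This weakens the conditions in the Hypercyclicity Criterion: the vector that is sent close
  to \<open>0\<close> may depend on \<open>n\<close>. Both sequences run over all \<open>n\<close> rather than over a subsequence, which
  makes the null-linked vectors a subspace.
\<close>

definition null_linked :: "'v::ab_group_add set \<Rightarrow> ('v \<Rightarrow> real) \<Rightarrow> ('v \<Rightarrow> 'v) \<Rightarrow> 'v set" where
  "null_linked Y N U = {y\<in>Y.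
     (\<exists>v. (\<forall>n. v n \<in> Y) \<and> (\<lambda>n. N (v n - y)) \<longlonglongrightarrow> 0 \<and> (\<lambda>n. N ((U ^^ n) (v n))) \<longlonglongrightarrow> 0) \<and>
     (\<exists>u. (\<forall>n. u n \<in> Y) \<and> (\<lambda>n. N (u n)) \<longlonglongrightarrow> 0 \<and> (\<lambda>n. N ((U ^^ n) (u n) - y)) \<longlonglongrightarrow> 0)}"

lemma null_linkedE:
  assumes "y \<in> null_linked Y N U"
  obtains v u where "y \<in> Y" "\<And>n. v n \<in> Y" "(\<lambda>n. N (v n - y)) \<longlonglongrightarrow> 0"
    "(\<lambda>n. N ((U ^^ n) (v n))) \<longlonglongrightarrow> 0" "\<And>n. u n \<in> Y" "(\<lambda>n. N (u n)) \<longlonglongrightarrow> 0"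
    "(\<lambda>n. N ((U ^^ n) (u n) - y)) \<longlonglongrightarrow> 0"
  using assms by (auto simp: null_linked_def)

lemma null_linkedI:
  assumes "y \<in> Y" "\<And>n. v n \<in> Y" "(\<lambda>n. N (v n - y)) \<longlonglongrightarrow> 0"
    "(\<lambda>n. N ((U ^^ n) (v n))) \<longlonglongrightarrow> 0" "\<And>n. u n \<in> Y" "(\<lambda>n. N (u n)) \<longlonglongrightarrow> 0"
    "(\<lambda>n. N ((U ^^ n) (u n) - y)) \<longlonglongrightarrow> 0"
  shows "y \<in> null_linked Y N U"
  using assms by (auto simp: null_linked_def)

context normed_carrier
begin

lemma subspace_null_linked:
  assumes U: "bounded_operator_on sm Y N U"
  shows "subspace (null_linked Y N U)"
proof (rule subspaceI)
  note Un = bounded_operator_on_props[OF bounded_operator_on_funpow[OF U]]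
  show "0 \<in> null_linked Y N U"
    by (rule null_linkedI[where v = "\<lambda>_. 0" and u = "\<lambda>_. 0"]) (auto simp: Un(5))
  fix x assume x: "x \<in> null_linked Y N U"
  obtain v u where vu: "x \<in> Y" "\<And>n. v n \<in> Y" "(\<lambda>n. N (v n - x)) \<longlonglongrightarrow> 0"
    "(\<lambda>n. N ((U ^^ n) (v n))) \<longlonglongrightarrow> 0" "\<And>n. u n \<in> Y" "(\<lambda>n. N (u n)) \<longlonglongrightarrow> 0"
    "(\<lambda>n. N ((U ^^ n) (u n) - x)) \<longlonglongrightarrow> 0"
    by (rule null_linkedE[OF x], rule that)
  have lim_add: "(\<lambda>n. N (a n + b n)) \<longlonglongrightarrow> 0"
    if "\<And>n. a n \<in> Y" "\<And>n. b n \<in> Y" "(\<lambda>n. N (a n)) \<longlonglongrightarrow> 0" "(\<lambda>n. N (b n)) \<longlonglongrightarrow> 0" for a b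
    by (rule tendsto_0_bound[where C = 1 and g = "\<lambda>n. N (a n) + N (b n)"])
      (simp_all add: N_add that(1,2) tendsto_add_zero[OF that(3,4)])
  have lim_scale: "(\<lambda>n. N (sm c (a n))) \<longlonglongrightarrow> 0"
    if "\<And>n. a n \<in> Y" "(\<lambda>n. N (a n)) \<longlonglongrightarrow> 0" for a c
    by (rule tendsto_0_bound[OF _ _ that(2), where C = "norm c"]) (simp_all add: N_scale that(1))
  show "sm c x \<in> null_linked Y N U" for c
  proof (rule null_linkedI[where v = "\<lambda>n. sm c (v n)" and u = "\<lambda>n. sm c (u n)"])
    show "(\<lambda>n. N (sm c (v n) - sm c x)) \<longlonglongrightarrow> 0"
      using lim_scale[of "\<lambda>n. v n - x" c] vu by (simp add: scale_right_diff_distrib)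
    show "(\<lambda>n. N ((U ^^ n) (sm c (v n)))) \<longlonglongrightarrow> 0"
      using lim_scale[of "\<lambda>n. (U ^^ n) (v n)" c] vu by (simp add: Un)
    show "(\<lambda>n. N (sm c (u n))) \<longlonglongrightarrow> 0"
      using lim_scale[of u c] vu by simp
    show "(\<lambda>n. N ((U ^^ n) (sm c (u n)) - sm c x)) \<longlonglongrightarrow> 0"
      using lim_scale[of "\<lambda>n. (U ^^ n) (u n) - x" c] vu by (simp add: Un scale_right_diff_distrib)
  qed (use vu in auto)
  fix y assume y: "y \<in> null_linked Y N U"
  obtain v' u' where vu': "y \<in> Y" "\<And>n. v' n \<in> Y" "(\<lambda>n. N (v' n - y)) \<longlonglongrightarrow> 0"
    "(\<lambda>n. N ((U ^^ n) (v' n))) \<longlonglongrightarrow> 0" "\<And>n. u' n \<in> Y" "(\<lambda>n. N (u' n)) \<longlonglongrightarrow> 0"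
    "(\<lambda>n. N ((U ^^ n) (u' n) - y)) \<longlonglongrightarrow> 0"
    by (rule null_linkedE[OF y], rule that)
  show "x + y \<in> null_linked Y N U"
  proof (rule null_linkedI[where v = "\<lambda>n. v n + v' n" and u = "\<lambda>n. u n + u' n"])
    show "(\<lambda>n. N (v n + v' n - (x + y))) \<longlonglongrightarrow> 0"
      using lim_add[of "\<lambda>n. v n - x" "\<lambda>n. v' n - y"] vu vu' by (simp add: add_diff_add)
    show "(\<lambda>n. N ((U ^^ n) (v n + v' n))) \<longlonglongrightarrow> 0"
      using lim_add[of "\<lambda>n. (U ^^ n) (v n)" "\<lambda>n. (U ^^ n) (v' n)"] vu vu' by (simp add: Un)
    show "(\<lambda>n. N (u n + u' n)) \<longlonglongrightarrow> 0"
      using lim_add[of u u'] vu vu' by simp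
    show "(\<lambda>n. N ((U ^^ n) (u n + u' n) - (x + y))) \<longlonglongrightarrow> 0"
      using lim_add[of "\<lambda>n. (U ^^ n) (u n) - x" "\<lambda>n. (U ^^ n) (u' n) - y"] vu vu'
      by (simp add: Un add_diff_add)
  qed (use vu vu' in auto)
qed

text \<open>
  The density half of the Baire argument. If \<open>v\<^sub>n \<rightarrow> a'\<close> near \<open>a\<close> is sent to \<open>0\<close>, and \<open>u\<^sub>n \<rightarrow> 0\<close> is
  sent to \<open>c'\<close> near \<open>c\<close>, then \<open>x = v\<^sub>n + u\<^sub>n\<close> is near \<open>a\<close> and is sent near \<open>c\<close>. For the same \<open>n\<close>
  the sequence \<open>w\<^sub>n \<rightarrow> 0\<close> with images tending to \<open>a'\<close> supplies a small vector sent near \<open>x\<close>.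
\<close>

lemma ex_near_orbit_point:
  assumes U: "bounded_operator_on sm Y N U"
    and D: "dense_in (norm_topology Y N) (null_linked Y N U)"
    and "a \<in> Y" "c \<in> Y" "r > 0" "e > 0"
  shows "\<exists>x\<in>Y. N (x - a) < r \<and> (\<exists>n>m. N ((U ^^ n) x - c) < e \<and>
           (\<exists>u\<in>Y. N u < e \<and> N ((U ^^ n) u - x) < e))"
proof -
  note Un = bounded_operator_on_props[OF bounded_operator_on_funpow[OF U]]
  \<comment> \<open>Each estimate below adds at most three errors smaller than \<open>d\<close>.\<close>
  define d where "d = min r e / 4"
  have d: "d > 0" "4 * d \<le> r" "4 * d \<le> e" using assms by (auto simp: d_def)
  have "null_linked Y N U \<subseteq> Y" by (auto simp: null_linked_def)
  then obtain a' c' where a': "a' \<in> null_linked Y N U" "N (a' - a) < d"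
    and c': "c' \<in> null_linked Y N U" "N (c' - c) < d"
    using D dense_in_iff assms d by meson
  obtain v w where vw: "a' \<in> Y" "\<And>n. v n \<in> Y" "(\<lambda>n. N (v n - a')) \<longlonglongrightarrow> 0"
    "(\<lambda>n. N ((U ^^ n) (v n))) \<longlonglongrightarrow> 0" "\<And>n. w n \<in> Y" "(\<lambda>n. N (w n)) \<longlonglongrightarrow> 0"
    "(\<lambda>n. N ((U ^^ n) (w n) - a')) \<longlonglongrightarrow> 0"
    by (rule null_linkedE[OF a'(1)], rule that)
  obtain v' u where vu': "c' \<in> Y" "\<And>n. v' n \<in> Y" "(\<lambda>n. N (v' n - c')) \<longlonglongrightarrow> 0"
    "(\<lambda>n. N ((U ^^ n) (v' n))) \<longlonglongrightarrow> 0" "\<And>n. u n \<in> Y" "(\<lambda>n. N (u n)) \<longlonglongrightarrow> 0"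
    "(\<lambda>n. N ((U ^^ n) (u n) - c')) \<longlonglongrightarrow> 0"
    by (rule null_linkedE[OF c'(1)], rule that)
  have "\<forall>\<^sub>F n in sequentially. N (v n - a') < d \<and> N ((U ^^ n) (v n)) < d \<and> N (w n) < d \<and>
      N ((U ^^ n) (w n) - a') < d \<and> N (u n) < d \<and> N ((U ^^ n) (u n) - c') < d \<and> n > m"
    using vw(3,4,6,7) vu'(6,7) d(1) by (intro eventually_conj order_tendstoD(2) eventually_gt_at_top)
  then obtain n where n: "N (v n - a') < d" "N ((U ^^ n) (v n)) < d" "N (w n) < d"
      "N ((U ^^ n) (w n) - a') < d" "N (u n) < d" "N ((U ^^ n) (u n) - c') < d" "n > m"
    by (auto simp: eventually_sequentially)
  define x where "x = v n + u n"
  have xY: "x \<in> Y" using vw vu' by (simp add: x_def)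
  have xa': "N (x - a') < 2 * d"
    using N_add[of "v n - a'" "u n"] vw vu' n by (simp add: x_def algebra_simps)
  have 1: "N (x - a) < r"
    using N_triangle[of x a' a] xY xa' vw assms a' d by simp
  have eq: "(U ^^ n) x - c' = (U ^^ n) (v n) + ((U ^^ n) (u n) - c')"
    using vw vu' by (simp add: x_def Un algebra_simps)
  have "N ((U ^^ n) x - c') < 2 * d"
    using N_add[of "(U ^^ n) (v n)" "(U ^^ n) (u n) - c'"] Un(1) vw(2) vu'(1,5) n(2,6)
    unfolding eq by simp
  then have 2: "N ((U ^^ n) x - c) < e"
    using N_triangle[of "(U ^^ n) x" c' c] xY vu' assms c' d by (simp add: Un)
  have 3: "N ((U ^^ n) (w n) - x) < e"
    using N_triangle[of "(U ^^ n) (w n)" a' x] xY xa' vw n d N_diff_commute[of a' x] by (simp add: Un)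
  show ?thesis
    using 1 2 3 xY vw(5)[of n] n d by (intro bexI[of _ x] conjI exI[of _ n] bexI[of _ "w n"]) auto
qed

end

locale banach_carrier = normed_carrier +
  assumes complete: "mcomplete_of (norm_metric Y N)"
begin

text \<open>
  One countable family of dense open sets gives both properties of \<open>x\<close>: the centres \<open>c\<close> from a
  dense sequence make the orbit dense, and the additional centre \<open>0\<close> makes an approximate return
  to \<open>x\<close> from near \<open>0\<close> occur for the same \<open>n\<close> as a visit of the orbit near \<open>0\<close>.
\<close>

lemma ex_generic_vector:
  assumes U: "bounded_operator_on sm Y N U"
    and sep: "separable_space (norm_topology Y N)"
    and D: "dense_in (norm_topology Y N) (null_linked Y N U)"
  obtains x where "x \<in> Y"
    and "\<And>y e. y \<in> Y \<Longrightarrow> e > 0 \<Longrightarrow> \<exists>n. N ((U ^^ n) x - y) < e"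
    and "\<And>m e. e > 0 \<Longrightarrow> \<exists>n>m. N ((U ^^ n) x) < e \<and> (\<exists>u\<in>Y. N u < e \<and> N ((U ^^ n) u - x) < e)"
proof -
  note Un = bounded_operator_on_props[OF bounded_operator_on_funpow[OF U]]
  obtain C where C: "countable C" "C \<subseteq> Y" "norm_topology Y N closure_of C = Y"
    using sep by (auto simp: separable_space_def)
  then have Cd: "dense_in (norm_topology Y N) C" by (simp add: dense_in_def)
  define W where "W c m = {x\<in>Y. \<exists>n>m. N ((U ^^ n) x - c) < 1 / Suc m \<and>
      (\<exists>u\<in>Y. N u < 1 / Suc m \<and> N ((U ^^ n) u - x) < 1 / Suc m)}" for c m
  define G where "G = (\<lambda>(c, m). W c m) ` (insert 0 C \<times> UNIV)"
  have open_W: "openin (norm_topology Y N) (W c m)" if c: "c \<in> Y" for c m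
  proof (rule openin_norm_topology)
    show "W c m \<subseteq> Y" by (auto simp: W_def)
    fix x assume "x \<in> W c m"
    then obtain n u where x: "x \<in> Y" and n: "n > m" "N ((U ^^ n) x - c) < 1 / Suc m"
      and u: "u \<in> Y" "N u < 1 / Suc m" "N ((U ^^ n) u - x) < 1 / Suc m"
      by (auto simp: W_def)
    obtain r where r: "r > 0" "\<And>y. y \<in> Y \<Longrightarrow> N (y - x) < r \<Longrightarrow>
        N ((U ^^ n) y - (U ^^ n) x) < 1 / Suc m - N ((U ^^ n) x - c)"
      using bounded_operator_on_continuous[OF bounded_operator_on_funpow[OF U] x, of "1 / Suc m - N ((U ^^ n) x - c)" n] n
      by auto
    define s where "s = min r (1 / Suc m - N ((U ^^ n) u - x))"
    have "y \<in> W c m" if y: "y \<in> Y" "N (y - x) < s" for y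
    proof -
      have "N ((U ^^ n) y - c) < 1 / Suc m"
        using N_triangle[of "(U ^^ n) y" "(U ^^ n) x" c] r(2)[of y] x y c by (simp add: Un s_def)
      moreover have "N ((U ^^ n) u - y) < 1 / Suc m"
        using N_triangle[of "(U ^^ n) u" x y] x y u N_diff_commute[of x y] by (simp add: Un s_def)
      ultimately show ?thesis using y u n by (auto simp: W_def)
    qed
    then show "\<exists>e>0. \<forall>y\<in>Y. N (y - x) < e \<longrightarrow> y \<in> W c m"
      using r u by (intro exI[of _ s]) (auto simp: s_def)
  qed
  have dense_W: "dense_in (norm_topology Y N) (W c m)" if c: "c \<in> Y" for c m
  proof (subst dense_in_iff)
    show "W c m \<subseteq> Y" by (auto simp: W_def)
    show "\<forall>y\<in>Y. \<forall>e>0. \<exists>x\<in>W c m. N (x - y) < e"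
      using ex_near_orbit_point[OF U D _ c, of _ _ "1 / Suc m" m] unfolding W_def by fastforce
  qed
  have "metric.mcomplete"
    using complete by (simp add: norm_metric_def mcomplete_of_def)
  then have "metric.mtopology closure_of \<Inter>G = Y"
  proof (rule metric.metric_Baire_category)
    show "countable G" using C(1) by (auto simp: G_def)
    fix T assume "T \<in> G"
    then obtain c m where "c \<in> Y" "T = W c m" using C(2) by (auto simp: G_def)
    then show "openin metric.mtopology T \<and> metric.mtopology closure_of T = Y"
      using open_W dense_W by (auto simp: norm_topology_eq[symmetric] dense_in_def)
  qed
  then have "\<Inter>G \<noteq> {}"
    using carrier_closed(1) by (metis closure_of_empty empty_iff)
  then obtain x where x: "\<And>c m. c \<in> insert 0 C \<Longrightarrow> x \<in> W c m"
    by (auto simp: G_def)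
  have small: "\<exists>m\<ge>k. 1 / Suc m < e" if "e > 0" for e :: real and k
  proof -
    obtain m where "1 / Suc m < e" using nat_approx_posE[OF \<open>e > 0\<close>] .
    moreover have "1 / real (Suc (max k m)) \<le> 1 / Suc m" by (intro frac_le) auto
    ultimately show ?thesis
      by (intro exI[of _ "max k m"]) auto
  qed
  show ?thesis
  proof (rule that[of x])
    show xY: "x \<in> Y" using x[of 0 0] by (auto simp: W_def)
    show "\<exists>n>m. N ((U ^^ n) x) < e \<and> (\<exists>u\<in>Y. N u < e \<and> N ((U ^^ n) u - x) < e)"
      if e: "e > 0" for m e
    proof -
      obtain k where k: "k \<ge> m" "1 / Suc k < e" using small[OF e] by blast
      obtain n u where "n > k" "N ((U ^^ n) x - 0) < 1 / Suc k" "u \<in> Y" "N u < 1 / Suc k"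
        "N ((U ^^ n) u - x) < 1 / Suc k"
        using x[of 0 k] unfolding W_def by blast
      with k show ?thesis by (intro exI[of _ n] conjI bexI[of _ u]) auto
    qed
    show "\<exists>n. N ((U ^^ n) x - y) < e" if y: "y \<in> Y" and e: "e > 0" for y e
    proof -
      obtain c where c: "c \<in> C" "N (c - y) < e / 2"
        using Cd dense_in_iff[OF C(2)] y e by (meson half_gt_zero)
      obtain k where k: "1 / Suc k < e / 2" using small[of "e / 2"] e by auto
      obtain n where "N ((U ^^ n) x - c) < 1 / Suc k"
        using x[of c k] c unfolding W_def by blast
      then show ?thesis
        using N_triangle[of "(U ^^ n) x" c y] c C(2) y xY k
        by (intro exI[of _ n]) (auto simp: Un subset_iff)
    qed
  qed
qed

text \<open>
  The dense subspace is the orbit of the generic vector \<open>x\<close> under the whole commutant of \<open>U\<close>.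
  The orbit under the polynomials in \<open>U\<close> would be dense as well; the commutant contains them and
  needs no notation for evaluating a polynomial at \<open>U\<close>.
\<close>

lemma hypercyclicity_criterion_if_null_linked_dense:
  assumes U: "bounded_operator_on sm Y N U"
    and sep: "separable_space (norm_topology Y N)"
    and D: "dense_in (norm_topology Y N) (null_linked Y N U)"
  shows "hypercyclicity_criterion sm Y N U"
proof -
  note Un = bounded_operator_on_props[OF bounded_operator_on_funpow[OF U]]
  obtain x where xY: "x \<in> Y"
    and orbit: "\<And>y e. y \<in> Y \<Longrightarrow> e > 0 \<Longrightarrow> \<exists>n. N ((U ^^ n) x - y) < e"
    and rec: "\<And>m e. e > 0 \<Longrightarrow>
        \<exists>n>m. N ((U ^^ n) x) < e \<and> (\<exists>u\<in>Y. N u < e \<and> N ((U ^^ n) u - x) < e)"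
    using ex_generic_vector[OF U sep D] by blast
  have "\<exists>n. \<forall>k. (0 < n k \<and> N ((U ^^ n k) x) < 1 / Suc k \<and>
      (\<exists>u\<in>Y. N u < 1 / Suc k \<and> N ((U ^^ n k) u - x) < 1 / Suc k)) \<and> n k < n (Suc k)"
  proof (rule dependent_nat_choice)
    show "\<exists>n>0. N ((U ^^ n) x) < 1 / Suc 0 \<and>
        (\<exists>u\<in>Y. N u < 1 / Suc 0 \<and> N ((U ^^ n) u - x) < 1 / Suc 0)"
      using rec[of "1 / Suc 0" 0] by simp
    show "\<exists>m. (0 < m \<and> N ((U ^^ m) x) < 1 / Suc (Suc k) \<and>
        (\<exists>u\<in>Y. N u < 1 / Suc (Suc k) \<and> N ((U ^^ m) u - x) < 1 / Suc (Suc k))) \<and> n < m" for n k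
    proof -
      obtain m where "n < m" "N ((U ^^ m) x) < 1 / Suc (Suc k)"
        "\<exists>u\<in>Y. N u < 1 / Suc (Suc k) \<and> N ((U ^^ m) u - x) < 1 / Suc (Suc k)"
        using rec[of "1 / Suc (Suc k)" n] by auto
      then show ?thesis by (intro exI[of _ m] conjI) auto
    qed
  qed
  then obtain n where n: "\<And>k. 0 < n k" "\<And>k. N ((U ^^ n k) x) < 1 / Suc k" "\<And>k. n k < n (Suc k)"
    "\<And>k. \<exists>u\<in>Y. N u < 1 / Suc k \<and> N ((U ^^ n k) u - x) < 1 / Suc k"
    by blast
  then obtain u where u: "\<And>k. u k \<in> Y" "\<And>k. N (u k) < 1 / Suc k"
    "\<And>k. N ((U ^^ n k) (u k) - x) < 1 / Suc k"
    by metis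
  have mono: "strict_mono n" using n(3) by (simp add: strict_mono_Suc_iff)
  define Comm where "Comm = {P. bounded_operator_on sm Y N P \<and> (\<forall>y\<in>Y. P (U y) = U (P y))}"
  have bdd: "bounded_operator_on sm Y N P" if "P \<in> Comm" for P using that by (simp add: Comm_def)
  have comm: "P ((U ^^ k) y) = (U ^^ k) (P y)" if "P \<in> Comm" "y \<in> Y" for P k y
    using that(2) by (induction k) (use that in \<open>auto simp: Comm_def Un(1)\<close>)
  have add: "(\<lambda>y. P y + Q y) \<in> Comm" if "P \<in> Comm" "Q \<in> Comm" for P Q
    using that bounded_operator_on_add bounded_operator_on_props[OF U]
      bounded_operator_on_props(1)[OF bdd[OF that(1)]] bounded_operator_on_props(1)[OF bdd[OF that(2)]]
    by (auto simp: Comm_def)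
  have scale: "(\<lambda>y. sm c (P y)) \<in> Comm" if "P \<in> Comm" for P c
    using that bounded_operator_on_scale bounded_operator_on_props[OF U]
      bounded_operator_on_props(1)[OF bdd[OF that(1)]]
    by (auto simp: Comm_def)
  \<comment> \<open>\<open>P - Q\<close> vanishes at \<open>x\<close>, hence on its orbit, hence everywhere.\<close>
  have determined: "P y = Q y" if P: "P \<in> Comm" and Q: "Q \<in> Comm" and eq: "P x = Q x"
    and y: "y \<in> Y" for P Q y
  proof -
    have R: "(\<lambda>y. P y + sm (- 1) (Q y)) \<in> Comm" using add[OF P scale[OF Q]] .
    have "P y + sm (- 1) (Q y) = 0"
    proof (rule bounded_operator_on_zero_if_zero_on_dense[OF bdd[OF R]])
      show "range (\<lambda>k. (U ^^ k) x) \<subseteq> Y" using xY Un(1) by auto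
      show "\<exists>z\<in>range (\<lambda>k. (U ^^ k) x). N (z - y) < e" if "y \<in> Y" "e > 0" for y e
        using orbit[OF that] by auto
      show "P z + sm (- 1) (Q z) = 0" if "z \<in> range (\<lambda>k. (U ^^ k) x)" for z
        using that comm[OF P xY] comm[OF Q xY] eq by auto
    qed (rule y)
    then show ?thesis by simp
  qed
  define Y0 where "Y0 = (\<lambda>P. P x) ` Comm"
  define op where "op y = (SOME P. P \<in> Comm \<and> P x = y)" for y
  \<comment> \<open>The criterion indexes the maps by \<open>n k\<close>, the vectors \<open>u k\<close> by \<open>k\<close>.\<close>
  define S where "S m y = op y (u (inv n m))" for m y
  have op: "op y \<in> Comm" "op y x = y" if "y \<in> Y0" for y
    using that someI_ex[of "\<lambda>P. P \<in> Comm \<and> P x = y"] by (auto simp: Y0_def op_def)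
  have S: "S (n k) (P x) = P (u k)" if "P \<in> Comm" for P k
  proof -
    have "inv n (n k) = k" using mono by (simp add: strict_mono_imp_inj_on)
    moreover have "P x \<in> Y0" using that by (simp add: Y0_def)
    ultimately show ?thesis
      unfolding S_def using determined[OF op(1) that] op(2) u(1) by simp
  qed
  have Y0Y: "Y0 \<subseteq> Y"
    using bounded_operator_on_props(1)[OF bdd] xY by (auto simp: Y0_def)
  have "subspace Y0"
  proof (rule subspaceI)
    have "(\<lambda>y. 0) \<in> Comm"
      using bounded_operator_on_zero bounded_operator_on_props(5)[OF U] by (simp add: Comm_def)
    then show "0 \<in> Y0" by (force simp: Y0_def)
    show "a + b \<in> Y0" if "a \<in> Y0" "b \<in> Y0" for a b
      using that add by (force simp: Y0_def)
    show "sm c a \<in> Y0" if "a \<in> Y0" for c a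
      using that scale by (force simp: Y0_def)
  qed
  moreover have "dense_in (norm_topology Y N) Y0"
  proof (subst dense_in_iff[OF Y0Y], intro ballI allI impI)
    fix y and e :: real assume "y \<in> Y" "e > 0"
    then obtain k where k: "N ((U ^^ k) x - y) < e" using orbit by blast
    have "U ^^ k \<in> Comm"
      using bounded_operator_on_funpow[OF U] by (simp add: Comm_def funpow_swap1)
    then show "\<exists>z\<in>Y0. N (z - y) < e" using k by (auto simp: Y0_def)
  qed
  moreover have "linear_map_on sm Y0 Y (S (n k))" for k
    unfolding linear_map_on_def Y0_def
    using S[OF add] S[OF scale] S bounded_operator_on_props(1)[OF bdd] u
    by (auto simp: image_iff)
  moreover have "limitin (norm_topology Y N) (\<lambda>k. (U ^^ n k) y) 0 sequentially \<and>
      limitin (norm_topology Y N) (\<lambda>k. S (n k) y) 0 sequentially \<and>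
      limitin (norm_topology Y N) (\<lambda>k. (U ^^ n k) (S (n k) y)) y sequentially"
    if y: "y \<in> Y0" for y
  proof -
    obtain P where P: "P \<in> Comm" "y = P x" using y by (auto simp: Y0_def)
    note Pp = bounded_operator_on_props[OF bdd[OF P(1)]]
    obtain C where C: "C > 0" "\<And>x. x \<in> Y \<Longrightarrow> N (P x) \<le> C * N x" using Pp(6) by blast
    have lim: "(\<lambda>k. N (P (a k))) \<longlonglongrightarrow> 0" if a: "\<And>k. a k \<in> Y" "\<And>k. N (a k) < 1 / Suc k" for a
    proof (rule tendsto_0_bound[where C = C and g = "\<lambda>k. 1 / Suc k"])
      show "N (P (a k)) \<le> C * (1 / Suc k)" for k
        using C(2)[OF a(1)[of k]] mult_left_mono[OF less_imp_le[OF a(2)[of k]], of C] C(1) by simp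
      show "(\<lambda>k. 1 / real (Suc k)) \<longlonglongrightarrow> 0"
        using LIMSEQ_inverse_real_of_nat by (simp add: inverse_eq_divide)
    qed (use a Pp in auto)
    have "(U ^^ n k) (S (n k) y) - y = P ((U ^^ n k) (u k) - x)" for k
      using P S comm[OF P(1)] u xY by (simp add: Pp Un)
    then show ?thesis
      using lim[of "\<lambda>k. (U ^^ n k) x"] lim[of u] lim[of "\<lambda>k. (U ^^ n k) (u k) - x"] n u xY P S
      by (intro conjI limitin_norm_topology) (auto simp: Un Pp simp flip: comm)
  qed
  ultimately have "\<exists>Y0 (n :: nat \<Rightarrow> nat) (S :: nat \<Rightarrow> 'b \<Rightarrow> 'b).
        subspace Y0 \<and> dense_in (norm_topology Y N) Y0 \<and>
        strict_mono n \<and> (\<forall>k. 0 < n k) \<and>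
        (\<forall>k. linear_map_on sm Y0 Y (S (n k))) \<and>
        (\<forall>y\<in>Y0.
           limitin (norm_topology Y N) (\<lambda>k. (U ^^ n k) y) 0 sequentially \<and>
           limitin (norm_topology Y N) (\<lambda>k. S (n k) y) 0 sequentially \<and>
           limitin (norm_topology Y N) (\<lambda>k. (U ^^ n k) (S (n k) y)) y sequentially)"
    using mono n(1) by blast
  then show ?thesis
    unfolding hypercyclicity_criterion_def banach_on_def
    using U sep complete vs sub norm by blast
qed

end

section \<open>A Pade approximation of the exponential series\<close>

text \<open>
  The sum is the coefficient of \<open>X\<^sup>d\<close> in \<open>(1 + X)\<^sup>M ((1 + X) - 1)\<^sup>k = (1 + X)\<^sup>M X\<^sup>k\<close>.
\<close>

lemma alternating_binomial_sum:
  "(\<Sum>i\<le>k. (- 1) ^ i * real (k choose i) * real ((M + k - i) choose d)) =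
     (if k \<le> d then real (M choose (d - k)) else 0)"
proof -
  let ?A = "1 + fps_X :: real fps"
  have "fps_X ^ k * ?A ^ M = ((- 1) + ?A) ^ k * ?A ^ M"
    by simp
  also have "\<dots> = (\<Sum>i\<le>k. fps_const ((- 1) ^ i * real (k choose i)) * ?A ^ (M + k - i))"
  proof -
    have c: "(- 1) ^ i * of_nat (k choose i) = fps_const ((- 1) ^ i * real (k choose i))" for i
      by (simp add: fps_of_nat fps_const_power[symmetric] fps_const_mult[symmetric]
          fps_const_neg[symmetric] del: fps_const_mult fps_const_power fps_const_neg)
    show ?thesis
      unfolding binomial_ring[of "- 1" ?A k] sum_distrib_right
    proof (rule sum.cong[OF refl])
      fix i assume "i \<in> {..k}"
      then have "M + k - i = k - i + M" by simp
      then show "of_nat (k choose i) * (- 1) ^ i * ?A ^ (k - i) * ?A ^ M =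
          fps_const ((- 1) ^ i * real (k choose i)) * ?A ^ (M + k - i)"
        unfolding c[symmetric] by (simp add: power_add mult_ac)
    qed
  qed
  finally have "(fps_X ^ k * ?A ^ M) $ d =
      (\<Sum>i\<le>k. fps_const ((- 1) ^ i * real (k choose i)) * ?A ^ (M + k - i)) $ d"
    by simp
  moreover have "(?A ^ m) $ d = real (m choose d)" for m d
    using fps_binomial_nth[of "real m" d] by (simp add: fps_binomial_of_nat binomial_gbinomial)
  ultimately show ?thesis
    by (simp add: fps_sum_nth fps_X_power_mult_nth not_le split: if_splits)
qed

text \<open>
  Up to a constant factor \<open>Q\<close> is the denominator of the Pade approximant of type \<open>[j / j-1]\<close> of
  the exponential. The coefficient of \<open>s\<^sup>r\<close> in \<open>e\<^sup>s Q\<close> is an alternating sum as in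
  \<open>alternating_binomial_sum\<close> with \<open>k = j - 1\<close>, \<open>M = j\<close> and \<open>d = 2j - 1 - r\<close>: it vanishes when
  \<open>d < k\<close>, which means \<open>r > j\<close>, and \<open>d = k\<close> gives the normalisation at \<open>r = j\<close>.
\<close>

lemma exp_pade_remainder:
  fixes j :: nat
  assumes "0 < j"
  obtains Q :: "real fps"
  where "\<And>i. j \<le> i \<Longrightarrow> Q $ i = 0"
    and "(fps_exp 1 * Q) $ j = 1"
    and "\<And>i. j < i \<Longrightarrow> i < 2 * j \<Longrightarrow> (fps_exp 1 * Q) $ i = 0"
proof -
  obtain k where j: "j = Suc k" using assms by (cases j) auto
  define Q :: "real fps" where
    "Q = Abs_fps (\<lambda>i. (- 1) ^ i * real (k choose i) * fact (2 * k + 1 - i) / fact k)"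
  have Q0: "Q $ i = 0" if "j \<le> i" for i
    using that j by (simp add: Q_def)
  have coeff: "(fps_exp 1 * Q) $ r =
      fact d / fact k * (if k \<le> d then real (j choose (d - k)) else 0)"
    if r: "k \<le> r" "r \<le> 2 * k + 1" and d: "d = 2 * k + 1 - r" for r d
  proof -
    have "(fps_exp 1 * Q) $ r = (\<Sum>i=0..r. Q $ i / fact (r - i))"
      by (subst mult.commute) (simp add: fps_mult_nth)
    also have "\<dots> = (\<Sum>i\<le>k. Q $ i / fact (r - i))"
      using r Q0 j by (intro sum.mono_neutral_right) auto
    also have "\<dots> = (\<Sum>i\<le>k. fact d / fact k *
        ((- 1) ^ i * real (k choose i) * real ((j + k - i) choose d)))"
    proof (rule sum.cong[OF refl])
      fix i assume i: "i \<in> {..k}"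
      have "real ((j + k - i) choose d) = fact (j + k - i) / (fact d * fact (j + k - i - d))"
        using i r d j by (intro binomial_fact) auto
      moreover have "j + k - i - d = r - i" "2 * k + 1 - i = j + k - i"
        using i r d j by auto
      ultimately show "Q $ i / fact (r - i) = fact d / fact k *
        ((- 1) ^ i * real (k choose i) * real ((j + k - i) choose d))"
        by (simp add: Q_def)
    qed
    finally show ?thesis
      by (simp only: sum_distrib_left[symmetric] alternating_binomial_sum)
  qed
  show ?thesis
  proof (rule that[of Q])
    show "(fps_exp 1 * Q) $ j = 1"
      using coeff[of j k] j by simp
    show "(fps_exp 1 * Q) $ i = 0" if "j < i" "i < 2 * j" for i
      using coeff[of i "2 * k + 1 - i"] that j by simp
  qed (rule Q0)
qed

lemma tendsto_power_quotient:
  fixes c :: "nat \<Rightarrow> real"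
  assumes "filterlim c at_infinity sequentially" and "k < j"
  shows "(\<lambda>n. c n ^ k / c n ^ j) \<longlonglongrightarrow> 0"
proof (rule Lim_transform_eventually)
  have "(\<lambda>n. inverse (c n)) \<longlonglongrightarrow> 0"
    using filterlim_compose[OF tendsto_inverse_0 assms(1)] .
  from tendsto_power[OF this, of "j - k"]
  show "(\<lambda>n. inverse (c n) ^ (j - k)) \<longlonglongrightarrow> 0"
    using assms(2) by (simp add: power_0_left)
  have "\<forall>\<^sub>F n in sequentially. c n \<noteq> 0"
    using filterlim_at_infinity_imp_eventually_ne[OF assms(1)] .
  then show "\<forall>\<^sub>F n in sequentially. inverse (c n) ^ (j - k) = c n ^ k / c n ^ j"
  proof eventually_elim
    case (elim n)
    have "c n ^ j = c n ^ k * c n ^ (j - k)"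
      using assms(2) by (simp flip: power_add)
    with elim show ?case by (simp add: field_simps)
  qed
qed

text \<open>
  In \<open>c\<^bsup>-j\<^esup> A(c L)\<close> the coefficient \<open>A\<^sub>k\<close> carries the factor \<open>c\<^bsup>k-j\<^esup>\<close>, so in the limit only
  \<open>k = j\<close> survives, provided that no \<open>A\<^sub>k\<close> with \<open>k > j\<close> contributes.
\<close>

lemma rescaled_compose_tendsto:
  fixes A L :: "real fps"
  assumes c: "filterlim c at_infinity sequentially"
    and L0: "L $ 0 = 0"
    and A: "\<And>k. j < k \<Longrightarrow> k \<le> i \<Longrightarrow> A $ k = 0"
  shows "(\<lambda>n. (fps_const (1 / c n ^ j) * (A oo (fps_const (c n) * L))) $ i)
           \<longlonglongrightarrow> (fps_const (A $ j) * L ^ j) $ i"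
proof -
  have "(\<lambda>n. \<Sum>k=0..i. A $ k * (L ^ k $ i) * (c n ^ k / c n ^ j))
      \<longlonglongrightarrow> (\<Sum>k=0..i. A $ k * (L ^ k $ i) * (if k = j then 1 else 0))"
  proof (intro tendsto_sum)
    fix k assume k: "k \<in> {0..i}"
    consider "k < j" | "k = j" | "j < k" by linarith
    then show "(\<lambda>n. A $ k * (L ^ k $ i) * (c n ^ k / c n ^ j))
        \<longlonglongrightarrow> A $ k * (L ^ k $ i) * (if k = j then 1 else 0)"
    proof cases
      case 1
      then show ?thesis
        using tendsto_mult_left[OF tendsto_power_quotient[OF c], of k j] by simp
    next
      case 2
      have "\<forall>\<^sub>F n in sequentially. c n \<noteq> 0"
        using filterlim_at_infinity_imp_eventually_ne[OF c] .
      then have "\<forall>\<^sub>F n in sequentially. A $ k * (L ^ k $ i) =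
          A $ k * (L ^ k $ i) * (c n ^ k / c n ^ j)"
        by eventually_elim (simp add: 2)
      then show ?thesis
        using 2 by (intro Lim_transform_eventually[OF tendsto_const]) auto
    next
      case 3
      then show ?thesis using A k by simp
    qed
  qed
  moreover have "(\<Sum>k=0..i. A $ k * (L ^ k $ i) * (if k = j then 1 else 0)) =
      (fps_const (A $ j) * L ^ j) $ i"
    using startsby_zero_power_prefix[OF L0, of j]
    by (simp add: if_distrib sum.delta cong: if_cong)
  moreover have "(fps_const (1 / c n ^ j) * (A oo (fps_const (c n) * L))) $ i =
      (\<Sum>k=0..i. A $ k * (L ^ k $ i) * (c n ^ k / c n ^ j))" for n
    by (simp add: fps_compose_nth power_mult_distrib fps_const_power sum_distrib_left
        sum_divide_distrib mult_ac)
  ultimately show ?thesis by simp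
qed

lemma fps_mult_nth_tendsto:
  fixes f :: "nat \<Rightarrow> real fps"
  assumes "\<And>k. k \<le> i \<Longrightarrow> (\<lambda>n. f n $ k) \<longlonglongrightarrow> g $ k"
  shows "(\<lambda>n. (f n * h) $ i) \<longlonglongrightarrow> (g * h) $ i"
  unfolding fps_mult_nth using assms by (intro tendsto_intros) auto

text \<open>
  The heart of the matter: modulo \<open>X\<^bsup>2j\<^esup>\<close>, the series \<open>exp (c\<^sub>n L)\<close> carry a null sequence to a
  sequence with limit \<open>X\<^sup>j\<close>. The null sequence is \<open>c\<^sub>n\<^bsup>-j\<^esup> Q(c\<^sub>n L) (L/X)\<^bsup>-j\<^esup>\<close> with the Pade
  denominator \<open>Q\<close>. General \<open>c\<^sub>n\<close> are allowed because both \<open>c\<^sub>n = n\<close> and \<open>c\<^sub>n = -n\<close> are needed.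
\<close>

lemma fps_exp_transports_null_sequence:
  fixes L :: "real fps" and c :: "nat \<Rightarrow> real"
  assumes L: "L $ 0 = 0" "L $ 1 \<noteq> 0"
    and c: "filterlim c at_infinity sequentially" and "0 < j"
  obtains u :: "nat \<Rightarrow> real fps"
  where "\<And>i. (\<lambda>n. u n $ i) \<longlonglongrightarrow> 0"
    and "\<And>i. i < 2 * j \<Longrightarrow> (\<lambda>n. ((fps_exp (c n) oo L) * u n) $ i) \<longlonglongrightarrow> (fps_X ^ j) $ i"
proof -
  obtain Q :: "real fps" where Q: "\<And>i. j \<le> i \<Longrightarrow> Q $ i = 0"
    "(fps_exp 1 * Q) $ j = 1" "\<And>i. j < i \<Longrightarrow> i < 2 * j \<Longrightarrow> (fps_exp 1 * Q) $ i = 0"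
    using exp_pade_remainder[OF \<open>0 < j\<close>] by blast
  define G where "G = fps_shift 1 L"
  have LG: "L = fps_X * G"
    using L by (intro fps_ext) (auto simp: G_def)
  have G0: "G $ 0 \<noteq> 0" using L by (simp add: G_def)
  define w where "w n = fps_const (1 / c n ^ j) * (Q oo (fps_const (c n) * L))" for n
  define u where "u n = w n * inverse (G ^ j)" for n
  have exp_w: "(fps_exp (c n) oo L) * w n =
      fps_const (1 / c n ^ j) * ((fps_exp 1 * Q) oo (fps_const (c n) * L))" for n
  proof -
    have "fps_exp (c n) oo L = (fps_exp 1 oo (fps_const (c n) * fps_X)) oo L"
      by simp
    also have "\<dots> = fps_exp 1 oo ((fps_const (c n) * fps_X) oo L)"
      using L by (simp add: fps_compose_assoc del: fps_exp_compose_linear)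
    also have "(fps_const (c n) * fps_X) oo L = fps_const (c n) * L"
      using L by (simp add: fps_compose_mult_distrib)
    finally show ?thesis
      using L by (simp add: w_def fps_compose_mult_distrib mult_ac)
  qed
  show ?thesis
  proof (rule that[of u])
    show "(\<lambda>n. u n $ i) \<longlonglongrightarrow> 0" for i
      using fps_mult_nth_tendsto[of i w 0 "inverse (G ^ j)"]
        rescaled_compose_tendsto[OF c L(1), of j _ Q] Q(1)
      by (simp add: u_def w_def)
    show "(\<lambda>n. ((fps_exp (c n) oo L) * u n) $ i) \<longlonglongrightarrow> (fps_X ^ j) $ i" if "i < 2 * j" for i
    proof -
      have "(\<lambda>n. ((fps_exp (c n) oo L) * w n) $ k) \<longlonglongrightarrow> L ^ j $ k" if "k \<le> i" for k
        using rescaled_compose_tendsto[OF c L(1), of j k "fps_exp 1 * Q"] Q \<open>i < 2 * j\<close> that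
        unfolding exp_w by simp
      from fps_mult_nth_tendsto[OF this, of i "inverse (G ^ j)"]
      have "(\<lambda>n. ((fps_exp (c n) oo L) * u n) $ i) \<longlonglongrightarrow> (L ^ j * inverse (G ^ j)) $ i"
        by (simp add: u_def mult.assoc)
      also have "L ^ j * inverse (G ^ j) = fps_X ^ j * (G ^ j * inverse (G ^ j))"
        unfolding LG by (simp add: power_mult_distrib mult.assoc)
      also have "G ^ j * inverse (G ^ j) = 1"
        using G0 by (intro inverse_mult_eq_1') (simp add: fps_nth_power_0)
      finally show ?thesis by simp
    qed
  qed
qed

lemma fps_exp_compose_ln: "fps_exp 1 oo fps_ln 1 = (1 + fps_X :: real fps)"
proof -
  have "(fps_exp 1 - 1) oo fps_ln 1 = (fps_X :: real fps)"
    using fps_inv_fps_exp_compose(2)[of "1::real"] by (simp add: fps_ln_fps_exp_inv)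
  then show ?thesis
    by (simp add: fps_compose_sub_distrib algebra_simps)
qed

section \<open>Power series acting on the generalised kernel\<close>

lemma op_pow_0 [simp]: "op_pow T 0 = id_blinfun"
  and op_pow_Suc: "op_pow T (Suc n) = T o\<^sub>L op_pow T n"
  by (simp_all add: op_pow_def)

lemma op_pow_add: "op_pow T (i + k) = op_pow T i o\<^sub>L op_pow T k"
  by (induction i) (auto simp: op_pow_Suc intro!: blinfun_eqI)

lemma norm_op_pow_le: "norm (op_pow T n) \<le> norm T ^ n"
proof (induction n)
  case 0
  then show ?case using norm_blinfun_id_le by simp
next
  case (Suc n)
  have "norm (op_pow T (Suc n)) \<le> norm T * norm (op_pow T n)"
    by (simp add: op_pow_Suc norm_blinfun_compose)
  also have "\<dots> \<le> norm T * norm T ^ n" using Suc by (intro mult_left_mono) auto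
  finally show ?case by simp
qed

lemma op_pow_eq_0_mono:
  assumes "op_pow T m y = 0" "m \<le> i"
  shows "op_pow T i y = 0"
  using op_pow_add[of T "i - m" m] assms by (simp add: blinfun.zero_right)

text \<open>
  The action of \<open>f(T)\<close> on vectors that are annihilated by \<open>T\<^sup>m\<close>, where the sum over all powers of
  \<open>T\<close> stops at \<open>m\<close>. Multiplicativity in \<open>f\<close> rests on the vanishing of the higher powers.
\<close>

definition fps_act :: "('a::real_normed_vector \<Rightarrow>\<^sub>L 'a) \<Rightarrow> nat \<Rightarrow> real fps \<Rightarrow> 'a \<Rightarrow> 'a" where
  "fps_act T m f y = (\<Sum>i<m. (f $ i) *\<^sub>R op_pow T i y)"

lemma op_pow_fps_act:
  assumes "op_pow T m y = 0"
  shows "op_pow T m (fps_act T m f y) = 0"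
proof -
  have "op_pow T m (op_pow T i y) = 0" for i
    using op_pow_eq_0_mono[OF assms, of "m + i"] by (simp add: op_pow_add)
  then show ?thesis
    by (simp add: fps_act_def blinfun.sum_right blinfun.scaleR_right)
qed

lemma fps_act_mult:
  assumes y: "op_pow T m y = 0"
  shows "fps_act T m f (fps_act T m g y) = fps_act T m (f * g) y"
proof -
  let ?h = "\<lambda>i k. (f $ i * g $ k) *\<^sub>R op_pow T (i + k) y"
  have nonzero: "i < m" if "op_pow T i y \<noteq> 0" for i
    using op_pow_eq_0_mono[OF y, of i] that by linarith
  have "fps_act T m f (fps_act T m g y) = (\<Sum>(i, k)\<in>{..<m} \<times> {..<m}. ?h i k)"
    by (simp add: fps_act_def blinfun.sum_right blinfun.scaleR_right scaleR_sum_right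
        op_pow_add sum.cartesian_product)
  also have "\<dots> = (\<Sum>(i, k)\<in>{(i, k). i + k < m}. ?h i k)"
    by (intro sum.mono_neutral_right) (auto intro: nonzero)
  also have "\<dots> = fps_act T m (f * g) y"
    by (simp add: sum.triangle_reindex fps_act_def fps_mult_nth scaleR_sum_left atMost_atLeast0)
  finally show ?thesis .
qed

lemma fps_act_tendsto:
  assumes "\<And>i. i < m \<Longrightarrow> (\<lambda>n. f n $ i) \<longlonglongrightarrow> g $ i"
  shows "(\<lambda>n. fps_act T m (f n) y) \<longlonglongrightarrow> fps_act T m g y"
  unfolding fps_act_def using assms by (intro tendsto_intros) auto

lemma fps_act_X_power: "j < m \<Longrightarrow> fps_act T m (fps_X ^ j) y = op_pow T j y"
  by (simp add: fps_act_def fps_X_power_iff if_distrib[of "\<lambda>a. a *\<^sub>R _"] cong: if_cong)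

text \<open>
  The null sequence \<open>u\<^sub>n\<close> that \<open>exp (n L)\<close> carries to \<open>X\<^sup>j\<close> gives one of the two sequences. For the
  other, let \<open>w\<^sub>n\<close> be the null sequence for \<open>exp (-n L)\<close>; then \<open>v\<^sub>n = exp (-n L) w\<^sub>n\<close> tends to
  \<open>X\<^sup>j\<close>, and \<open>exp (n L)\<close> brings it back to \<open>w\<^sub>n\<close>.
\<close>

lemma null_linked_if_exp_action:
  fixes T V :: "'a::real_normed_vector \<Rightarrow>\<^sub>L 'a"
  assumes L: "L $ 0 = 0" "L $ 1 \<noteq> 0"
    and V: "\<And>m z. 2 \<le> m \<Longrightarrow> op_pow T m z = 0 \<Longrightarrow>
      V z = fps_act T m (fps_exp 1 oo L) z"
    and x: "op_pow T j x = 0" "x \<in> range (op_pow T j)"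
  shows "x \<in> null_linked UNIV norm V"
proof (cases "j = 0")
  case True
  then have "x = 0" using x by simp
  moreover have "(blinfun_apply V ^^ n) 0 = 0" for n
    by (induction n) (simp_all add: blinfun.zero_right)
  ultimately show ?thesis
    by (intro null_linkedI[where v = "\<lambda>_. 0" and u = "\<lambda>_. 0"]) auto
next
  case False
  \<comment> \<open>\<open>T\<^sup>j y = x\<close> and \<open>T\<^sup>j x = 0\<close>, so \<open>T\<close> is nilpotent of order \<open>2j\<close> on \<open>y\<close>.\<close>
  define m where "m = 2 * j"
  obtain y where y: "x = op_pow T j y" using x by auto
  have ym: "op_pow T m y = 0"
    using x y by (simp add: m_def mult_2 op_pow_add)
  have V_pow: "(blinfun_apply V ^^ n) (fps_act T m g y) = fps_act T m ((fps_exp (real n) oo L) * g) y" for n g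
  proof (induction n)
    case (Suc n)
    have e: "(fps_exp (real (Suc n)) oo L) = (fps_exp 1 oo L) * (fps_exp (real n) oo L)"
      using L by (simp add: fps_compose_mult_distrib[symmetric] fps_exp_add_mult[symmetric] add.commute)
    have "(blinfun_apply V ^^ Suc n) (fps_act T m g y) = V (fps_act T m ((fps_exp (real n) oo L) * g) y)"
      using Suc by simp
    also have "\<dots> = fps_act T m ((fps_exp (real (Suc n)) oo L) * g) y"
      using V[OF _ op_pow_fps_act[OF ym]] False
      by (simp add: m_def fps_act_mult[OF ym[unfolded m_def]] e mult.assoc del: of_nat_Suc)
    finally show ?case .
  qed simp
  have act_X: "fps_act T m (fps_X ^ j) y = x"
    using False y by (simp add: fps_act_X_power m_def)
  have act_0: "fps_act T m 0 y = 0" by (simp add: fps_act_def)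
  have "filterlim real at_infinity sequentially"
    using tendsto_of_nat .
  then obtain u where u: "\<And>i. (\<lambda>n. u n $ i) \<longlonglongrightarrow> 0"
    "\<And>i. i < 2 * j \<Longrightarrow> (\<lambda>n. ((fps_exp (real n) oo L) * u n) $ i) \<longlonglongrightarrow> (fps_X ^ j) $ i"
    using fps_exp_transports_null_sequence[OF L] False by blast
  have "filterlim (\<lambda>n. - real n) at_infinity sequentially"
    using tendsto_of_nat[where 'a = real] by (simp add: filterlim_at_infinity_conv_norm_at_top)
  then obtain w where w: "\<And>i. (\<lambda>n. w n $ i) \<longlonglongrightarrow> 0"
    "\<And>i. i < 2 * j \<Longrightarrow> (\<lambda>n. ((fps_exp (- real n) oo L) * w n) $ i) \<longlonglongrightarrow> (fps_X ^ j) $ i"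
    using fps_exp_transports_null_sequence[OF L] False by blast
  have cancel: "(fps_exp (real n) oo L) * ((fps_exp (- real n) oo L) * w n) = w n" for n
  proof -
    have "(fps_exp (real n) oo L) * (fps_exp (- real n) oo L) = 1"
      using L by (simp add: fps_compose_mult_distrib[symmetric] fps_exp_add_mult[symmetric])
    then show ?thesis by (simp add: mult.assoc[symmetric])
  qed
  show ?thesis
  proof (rule null_linkedI[where v = "\<lambda>n. fps_act T m ((fps_exp (- real n) oo L) * w n) y"
        and u = "\<lambda>n. fps_act T m (u n) y"])
    have "(\<lambda>n. fps_act T m ((fps_exp (- real n) oo L) * w n) y) \<longlonglongrightarrow> fps_act T m (fps_X ^ j) y"
      using w(2) by (intro fps_act_tendsto) (simp add: m_def)
    then show "(\<lambda>n. norm (fps_act T m ((fps_exp (- real n) oo L) * w n) y - x)) \<longlonglongrightarrow> 0"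
      unfolding act_X by (intro tendsto_norm_zero LIM_zero)
    have "(\<lambda>n. fps_act T m (w n) y) \<longlonglongrightarrow> fps_act T m 0 y"
      using w(1) by (intro fps_act_tendsto) simp
    then show "(\<lambda>n. norm ((blinfun_apply V ^^ n) (fps_act T m ((fps_exp (- real n) oo L) * w n) y))) \<longlonglongrightarrow> 0"
      unfolding V_pow cancel act_0 by (intro tendsto_norm_zero)
    have "(\<lambda>n. fps_act T m (u n) y) \<longlonglongrightarrow> fps_act T m 0 y"
      using u(1) by (intro fps_act_tendsto) simp
    then show "(\<lambda>n. norm (fps_act T m (u n) y)) \<longlonglongrightarrow> 0"
      unfolding act_0 by (intro tendsto_norm_zero)
    have "(\<lambda>n. fps_act T m ((fps_exp (real n) oo L) * u n) y) \<longlonglongrightarrow> fps_act T m (fps_X ^ j) y"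
      using u(2) by (intro fps_act_tendsto) (simp add: m_def)
    then show "(\<lambda>n. norm ((blinfun_apply V ^^ n) (fps_act T m (u n) y) - x)) \<longlonglongrightarrow> 0"
      unfolding V_pow act_X by (intro tendsto_norm_zero LIM_zero)
  qed auto
qed

section \<open>Left multiplication on an admissible ideal\<close>

context banach_space_over
begin

lemma normed_carrier_UNIV: "normed_carrier sm UNIV norm"
  by unfold_locales (auto simp: norm_on_def norm_scale norm_triangle_ineq scale_right_distrib scale_left_distrib)

lemma bounded_opsI:
  fixes A :: "'a \<Rightarrow>\<^sub>L 'a"
  assumes "\<And>c x. A (sm c x) = sm c (A x)"
  shows "A \<in> bounded_ops sm"
  using assms by (auto simp: bounded_ops_def Vector_Spaces.linear_iff vector_space_axioms blinfun.add_right)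

lemma bounded_ops_scale: "A \<in> bounded_ops sm \<Longrightarrow> blinfun_apply A (sm c x) = sm c (blinfun_apply A x)"
  by (auto simp: bounded_ops_def Vector_Spaces.linear_iff)

lemma id_bounded_ops: "id_blinfun \<in> bounded_ops sm"
  by (rule bounded_opsI) simp

lemma op_pow_scale: "T \<in> bounded_ops sm \<Longrightarrow> op_pow T n (sm c x) = sm c (op_pow T n x)"
  by (induction n) (auto simp: op_pow_Suc bounded_ops_scale)

lemma bounded_operator_on_UNIV:
  assumes "A \<in> bounded_ops sm"
  shows "bounded_operator_on sm UNIV norm A"
  unfolding bounded_operator_on_def linear_map_on_def
  using norm_blinfun[of A] bounded_ops_scale[OF assms]
  by (auto simp: blinfun.add_right mult.commute intro!: exI[of _ "norm A"])

lemma left_mult_rank_one: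
  assumes "A \<in> bounded_ops sm"
  shows "left_mult A (rank_one sm f x) = rank_one sm f (A x)"
  by (auto intro!: blinfun_eqI simp: left_mult_def rank_one_apply bounded_ops_scale[OF assms])

lemma funpow_left_mult_rank_one:
  assumes "A \<in> bounded_ops sm"
  shows "(left_mult A ^^ n) (rank_one sm f x) = rank_one sm f ((blinfun_apply A ^^ n) x)"
  by (induction n) (simp_all add: left_mult_rank_one[OF assms])

lemma rank_one_diff: "rank_one sm f x - rank_one sm f y = rank_one sm f (x - y)"
  by (auto intro!: blinfun_eqI simp: rank_one_apply blinfun.diff_left scale_right_diff_distrib)

lemma banach_carrier_ideal:
  assumes "banach_ideal sm J N"
  shows "banach_carrier (op_scale sm) J N"
  using assms
  by (auto simp: banach_ideal_def banach_on_def banach_carrier_def normed_carrier_def banach_carrier_axioms_def)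

lemma bounded_operator_on_left_mult:
  assumes J: "banach_ideal sm J N" and A: "A \<in> bounded_ops sm"
  shows "bounded_operator_on (op_scale sm) J N (left_mult A)"
proof -
  interpret J: banach_carrier "op_scale sm" J N by (rule banach_carrier_ideal[OF J])
  have AS: "left_mult A S \<in> J" "N (left_mult A S) \<le> norm A * N S" if S: "S \<in> J" for S
  proof -
    have comp_id: "A o\<^sub>L S o\<^sub>L id_blinfun = A o\<^sub>L S"
      by (auto intro!: blinfun_eqI)
    have *: "left_mult A S \<in> J \<and> N (left_mult A S) \<le> norm A * norm (id_blinfun :: 'a \<Rightarrow>\<^sub>L 'a) * N S"
      using J A S id_bounded_ops unfolding banach_ideal_def left_mult_def
      by (metis comp_id)
    then show "left_mult A S \<in> J" by simp
    have "norm A * norm (id_blinfun :: 'a \<Rightarrow>\<^sub>L 'a) * N S \<le> norm A * 1 * N S"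
      using S by (intro mult_right_mono mult_left_mono norm_blinfun_id_le) auto
    with * show "N (left_mult A S) \<le> norm A * N S" by simp
  qed
  have "left_mult A (op_scale sm c S) = op_scale sm c (left_mult A S)" for c S
    by (auto intro!: blinfun_eqI simp: left_mult_def op_scale_apply bounded_ops_scale[OF A])
  moreover have "left_mult A (S + R) = left_mult A S + left_mult A R" for S R
    by (auto intro!: blinfun_eqI simp: left_mult_def blinfun.add_left blinfun.add_right)
  ultimately show ?thesis
    using AS unfolding bounded_operator_on_def linear_map_on_def by blast
qed

lemma rank_one_null_linked:
  assumes J: "banach_ideal sm J N" and A: "A \<in> bounded_ops sm"
    and f: "f \<in> dual_space sm" and x: "x \<in> null_linked UNIV norm (blinfun_apply A)"
  shows "rank_one sm f x \<in> null_linked J N (left_mult A)"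
proof -
  have R: "rank_one sm f z \<in> J" "N (rank_one sm f z) = norm f * norm z" for z
    using J f by (auto simp: banach_ideal_def)
  obtain v u where vu: "(\<lambda>n. norm (v n - x)) \<longlonglongrightarrow> 0"
    "(\<lambda>n. norm ((blinfun_apply A ^^ n) (v n))) \<longlonglongrightarrow> 0" "(\<lambda>n. norm (u n)) \<longlonglongrightarrow> 0"
    "(\<lambda>n. norm ((blinfun_apply A ^^ n) (u n) - x)) \<longlonglongrightarrow> 0"
    by (rule null_linkedE[OF x], rule that)
  show ?thesis
    using vu[THEN tendsto_mult_right_zero, of "norm f"]
    by (intro null_linkedI[where v = "\<lambda>n. rank_one sm f (v n)" and u = "\<lambda>n. rank_one sm f (u n)"])
      (simp_all add: R funpow_left_mult_rank_one[OF A] rank_one_diff)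
qed

text \<open>
  The vectors \<open>K\<close> that null-linked ones approximate form a subspace. It contains the rank one
  operators \<open>f \<otimes> x\<close> for arbitrary \<open>x\<close>, because \<open>x\<close> can be approximated from the span of \<open>G\<close> and
  the ideal norm of \<open>f \<otimes> z\<close> is \<open>\<parallel>f\<parallel> \<parallel>z\<parallel>\<close>. So it contains all finite rank operators, which are
  dense.
\<close>

lemma null_linked_left_mult_dense:
  assumes J: "admissible_banach_ideal sm J N" and A: "A \<in> bounded_ops sm"
    and G: "G \<subseteq> null_linked UNIV norm A" "closure (span G) = UNIV"
  shows "dense_in (norm_topology J N) (null_linked J N (left_mult A))"
proof -
  have I: "banach_ideal sm J N" and F: "dense_in (norm_topology J N) (finite_rank_ops sm)"
    using J by (auto simp: admissible_banach_ideal_def)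
  interpret J: banach_carrier "op_scale sm" J N by (rule banach_carrier_ideal[OF I])
  interpret X: normed_carrier sm UNIV norm by (rule normed_carrier_UNIV)
  let ?D = "null_linked J N (left_mult A)"
  have D: "J.subspace ?D"
    by (rule J.subspace_null_linked[OF bounded_operator_on_left_mult[OF I A]])
  have DJ: "?D \<subseteq> J" by (auto simp: null_linked_def)
  have span_G: "span G \<subseteq> null_linked UNIV norm A"
    by (rule span_minimal[OF G(1) X.subspace_null_linked[OF bounded_operator_on_UNIV[OF A]]])
  define K where "K = {S\<in>J. \<forall>e>0. \<exists>R\<in>?D. N (R - S) < e}"
  have approx: "\<exists>R\<in>?D. N (R - S) < d" if "S \<in> K" "d > 0" for S d
    using that by (simp add: K_def)
  have "J.subspace K"
  proof (rule J.subspaceI)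
    show "0 \<in> K"
      using J.subspace_0[OF D] by (force simp: K_def)
    fix S assume S: "S \<in> K"
    show "op_scale sm c S \<in> K" for c
    proof -
      have "\<exists>R\<in>?D. N (R - op_scale sm c S) < e" if e: "e > 0" for e
      proof -
        have "norm c + 1 > 0" by (simp add: add_nonneg_pos)
        then have "e / (norm c + 1) > 0" using e by simp
        then obtain R where R: "R \<in> ?D" "N (R - S) < e / (norm c + 1)"
          using S unfolding K_def by blast
        have RS: "R - S \<in> J" using R DJ S by (auto simp: K_def)
        have "N (op_scale sm c R - op_scale sm c S) = norm c * N (R - S)"
          using J.N_scale[OF RS] by (simp add: J.scale_right_diff_distrib)
        also have "\<dots> \<le> (norm c + 1) * N (R - S)"
          using RS by (intro mult_right_mono) auto
        also have "\<dots> < e" using R(2) \<open>norm c + 1 > 0\<close> by (simp add: field_simps)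
        finally show ?thesis using J.subspace_scale[OF D R(1)] by blast
      qed
      then show ?thesis using S by (auto simp: K_def)
    qed
    fix S' assume S': "S' \<in> K"
    have "\<exists>R\<in>?D. N (R - (S + S')) < e" if e: "e > 0" for e
    proof -
      obtain R R' where R: "R \<in> ?D" "N (R - S) < e / 2" "R' \<in> ?D" "N (R' - S') < e / 2"
        using approx[OF S half_gt_zero[OF e]] approx[OF S' half_gt_zero[OF e]] by blast
      have "R - S \<in> J" "R' - S' \<in> J" using R DJ S S' by (auto simp: K_def)
      then have "N (R + R' - (S + S')) < e"
        using J.N_add[of "R - S" "R' - S'"] R by (simp add: add_diff_add)
      then show ?thesis using J.subspace_add[OF D R(1,3)] by blast
    qed
    then show "S + S' \<in> K" using S S' by (auto simp: K_def)
  qed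
  moreover have "{rank_one sm f x | f x. f \<in> dual_space sm} \<subseteq> K"
  proof clarify
    fix f x assume f: "f \<in> dual_space sm"
    have R: "rank_one sm f z \<in> J" "N (rank_one sm f z) = norm f * norm z" for z
      using I f by (auto simp: banach_ideal_def)
    have "\<exists>R\<in>?D. N (R - rank_one sm f x) < e" if e: "e > 0" for e
    proof -
      have pos: "norm f + 1 > 0" by (simp add: add_nonneg_pos)
      have "x \<in> closure (span G)" using G by simp
      then obtain z where z: "z \<in> span G" "dist z x < e / (norm f + 1)"
        using e pos unfolding closure_approachable by (meson divide_pos_pos)
      have "N (rank_one sm f z - rank_one sm f x) = norm f * norm (z - x)"
        by (simp add: rank_one_diff R)
      also have "\<dots> \<le> (norm f + 1) * norm (z - x)" by (intro mult_right_mono) auto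
      also have "\<dots> < e" using z(2) pos by (simp add: field_simps dist_norm)
      finally show ?thesis
        using rank_one_null_linked[OF I A f] span_G z(1) by blast
    qed
    then show "rank_one sm f x \<in> K" using R by (simp add: K_def)
  qed
  ultimately have FK: "finite_rank_ops sm \<subseteq> K"
    unfolding finite_rank_ops_def by (intro J.span_minimal)
  then have FJ: "finite_rank_ops sm \<subseteq> J" by (auto simp: K_def)
  show ?thesis
  proof (subst J.dense_in_iff[OF DJ], intro ballI allI impI)
    fix S and e :: real assume S: "S \<in> J" and e: "e > 0"
    obtain P where P: "P \<in> finite_rank_ops sm" "N (P - S) < e / 2"
      using F S e unfolding J.dense_in_iff[OF FJ] by (meson half_gt_zero)
    then obtain R where R: "R \<in> ?D" "N (R - P) < e / 2"
      using FK approx[OF _ half_gt_zero[OF e]] by blast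
    have "N (R - S) < e"
      using J.N_triangle[of R P S] R P DJ FJ S by (auto simp: subset_iff)
    then show "\<exists>R\<in>?D. N (R - S) < e" using R(1) by blast
  qed
qed

lemma hypercyclicity_criterion_id_plus:
  assumes J: "admissible_banach_ideal sm J N"
    and sep: "separable_space (norm_topology J N)"
    and T: "extended_backward_shift sm T" and A: "A \<in> bounded_ops sm"
    and L: "L $ 0 = 0" "L $ 1 \<noteq> 0"
    and act: "\<And>m z. 2 \<le> m \<Longrightarrow> op_pow T m z = 0 \<Longrightarrow>
      z + A z = fps_act T m (fps_exp 1 oo L) z"
  shows "hypercyclicity_criterion (op_scale sm) J N (gen_derivation A (- id_blinfun))"
proof -
  let ?V = "id_blinfun + A"
  have V: "?V \<in> bounded_ops sm"
    by (rule bounded_opsI) (simp add: blinfun.add_left bounded_ops_scale[OF A] scale_right_distrib)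
  have eq: "gen_derivation A (- id_blinfun) = left_mult ?V"
    by (auto intro!: ext blinfun_eqI simp: gen_derivation_def left_mult_def right_mult_def
        blinfun.add_left blinfun.diff_left blinfun.minus_left blinfun.minus_right)
  have I: "banach_ideal sm J N" using J by (simp add: admissible_banach_ideal_def)
  interpret J: banach_carrier "op_scale sm" J N by (rule banach_carrier_ideal[OF I])
  have "(\<Union>j. {x. op_pow T j x = 0} \<inter> range (op_pow T j)) \<subseteq> null_linked UNIV norm ?V"
    using null_linked_if_exp_action[OF L, of T ?V] act by (auto simp: blinfun.add_left)
  then have "dense_in (norm_topology J N) (null_linked J N (left_mult ?V))"
    using T by (intro null_linked_left_mult_dense[OF J V]) (auto simp: extended_backward_shift_def)
  then show ?thesis
    unfolding eq
    by (intro J.hypercyclicity_criterion_if_null_linked_dense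
        bounded_operator_on_left_mult[OF I V] sep)
qed

end

section \<open>The two derivations\<close>

lemma summable_exp_op_pow:
  fixes T :: "'a::banach \<Rightarrow>\<^sub>L 'a"
  shows "summable (\<lambda>j. (1 / fact (Suc j)) *\<^sub>R op_pow T (Suc j))"
proof (rule summable_comparison_test')
  show "summable (\<lambda>j. inverse (fact (Suc j)) * norm T ^ Suc j)"
    using summable_exp[of "norm T"] by (subst summable_Suc_iff)
  show "norm ((1 / fact (Suc j)) *\<^sub>R op_pow T (Suc j)) \<le>
      inverse (fact (Suc j)) * norm T ^ Suc j" for j
    using norm_op_pow_le[of T "Suc j"] by (simp add: inverse_eq_divide divide_right_mono del: fact_Suc power_Suc)
qed

lemma exp_minus_id_apply:
  fixes T :: "'a::banach \<Rightarrow>\<^sub>L 'a"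
  shows "blinfun_apply (\<Sum>j. (1 / fact (Suc j)) *\<^sub>R op_pow T (Suc j)) x = (\<Sum>j. (1 / fact (Suc j)) *\<^sub>R op_pow T (Suc j) x)"
  and summable_exp_op_pow_apply: "summable (\<lambda>j. (1 / fact (Suc j)) *\<^sub>R op_pow T (Suc j) x)"
proof -
  have L: "bounded_linear (\<lambda>S :: 'a \<Rightarrow>\<^sub>L 'a. S x)"
    by (rule blinfun.bounded_linear_left)
  show "blinfun_apply (\<Sum>j. (1 / fact (Suc j)) *\<^sub>R op_pow T (Suc j)) x =
      (\<Sum>j. (1 / fact (Suc j)) *\<^sub>R op_pow T (Suc j) x)"
    using bounded_linear.suminf[OF L summable_exp_op_pow[of T]]
    by (simp add: blinfun.scaleR_left del: fact_Suc)
  show "summable (\<lambda>j. (1 / fact (Suc j)) *\<^sub>R op_pow T (Suc j) x)"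
    using bounded_linear.summable[OF L summable_exp_op_pow[of T]]
    by (simp add: blinfun.scaleR_left del: fact_Suc)
qed

lemma exp_minus_id_on_kernel:
  fixes T :: "'a::banach \<Rightarrow>\<^sub>L 'a"
  assumes "2 \<le> m" "op_pow T m z = 0"
  shows "z + (\<Sum>j. (1 / fact (Suc j)) *\<^sub>R op_pow T (Suc j)) z = fps_act T m (fps_exp 1) z"
proof -
  obtain k where m: "m = Suc k" using assms(1) by (cases m) auto
  have "(\<Sum>j. (1 / fact (Suc j)) *\<^sub>R op_pow T (Suc j) z) = (\<Sum>j<k. (1 / fact (Suc j)) *\<^sub>R op_pow T (Suc j) z)"
    using op_pow_eq_0_mono[OF assms(2)] m by (intro suminf_finite) auto
  then show ?thesis
    unfolding exp_minus_id_apply fps_act_def m sum.lessThan_Suc_shift by (simp del: fact_Suc)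
qed

lemma (in banach_space_over) exp_minus_id_bounded_ops:
  assumes "T \<in> bounded_ops sm"
  shows "(\<Sum>j. (1 / fact (Suc j)) *\<^sub>R op_pow T (Suc j)) \<in> bounded_ops sm"
proof (rule bounded_opsI)
  fix c x
  show "(\<Sum>j. (1 / fact (Suc j)) *\<^sub>R op_pow T (Suc j)) (sm c x) =
      sm c ((\<Sum>j. (1 / fact (Suc j)) *\<^sub>R op_pow T (Suc j)) x)"
    unfolding exp_minus_id_apply
    by (simp add: bounded_linear.suminf[OF bounded_linear_scale summable_exp_op_pow_apply]
        op_pow_scale[OF assms] scale_scaleR del: fact_Suc)
qed

theorem theorem2p2:
  fixes sm :: "'k::real_normed_field \<Rightarrow> 'a::banach \<Rightarrow> 'a"
    and J :: "('a \<Rightarrow>\<^sub>L 'a) set"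
    and norm_J :: "('a \<Rightarrow>\<^sub>L 'a) \<Rightarrow> real"
    and T :: "'a \<Rightarrow>\<^sub>L 'a"
  assumes "banach_space_over sm"
    and "admissible_banach_ideal sm J norm_J"
    and "separable_space (norm_topology J norm_J)"
    and "extended_backward_shift sm T"
  shows "hypercyclicity_criterion (op_scale sm) J norm_J
           (gen_derivation T (- id_blinfun)) \<and>
         hypercyclicity_criterion (op_scale sm) J norm_J
           (gen_derivation (\<Sum>j. (1 / fact (Suc j)) *\<^sub>R op_pow T (Suc j)) (- id_blinfun))"
proof
  interpret banach_space_over sm by (rule assms(1))
  have T: "T \<in> bounded_ops sm" using assms(4) by (simp add: extended_backward_shift_def)
  note criterion = hypercyclicity_criterion_id_plus[OF assms(2-4)]
  show "hypercyclicity_criterion (op_scale sm) J norm_J (gen_derivation T (- id_blinfun))"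
  proof (rule criterion[OF T, where L = "fps_ln 1"])
    fix m z assume "2 \<le> m" "op_pow T m z = 0"
    moreover obtain k where "m = Suc (Suc k)"
      using \<open>2 \<le> m\<close> by (metis add_2_eq_Suc le_Suc_ex)
    ultimately show "z + T z = fps_act T m (fps_exp 1 oo fps_ln 1) z"
      unfolding fps_exp_compose_ln fps_act_def
      by (simp add: sum.lessThan_Suc_shift op_pow_Suc del: sum.lessThan_Suc)
  qed (simp_all add: fps_ln_nth)
  show "hypercyclicity_criterion (op_scale sm) J norm_J
      (gen_derivation (\<Sum>j. (1 / fact (Suc j)) *\<^sub>R op_pow T (Suc j)) (- id_blinfun))"
    by (rule criterion[OF exp_minus_id_bounded_ops[OF T], where L = fps_X])
      (simp_all add: exp_minus_id_on_kernel del: fact_Suc)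
qed

end
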